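(* For every $d\in\mathbf{N}$, the threshold exponent $\alpha_{\Delta^d}$ satisfies $\alpha_{\Delta^d}\in[1,2)$.
   Context: $\mathbf{N}=\{1,2,\ldots\}$. $\mathbf{S}^d=\{x\in\mathbf{R}^{d+1}: |x|=1\}$ with geodesic distance $\rho(x,y)=\arccos(x\cdot y)$; $\mathcal{P}(\mathbf{S}^d)$ is the set of Borel probability measures on $\mathbf{S}^d$. Put $\Lambda(x,y)=\frac{2}{\pi}\min\{\rho(x,y),\pi-\rho(x,y)\}$. For exponents $\alpha\in(0,\infty]$ set $E_\alpha(\mu)=\frac12\iint\Lambda^\alpha(x,y)\,d\mu(x)\,d\mu(y)$, where $\Lambda^\infty(x,y)=1$ if $x\cdot y=0$ and $0$ otherwise. $\mathcal{P}_\Delta^=(\mathbf{S}^d)$ is the set of $\mu\in\mathcal{P}(\mathbf{S}^d)$ for which there is an orthonormal basis $\{v_0,\ldots,v_d\}$ of $\mathbf{R}^{d+1}$ with $\mu(\{v_i,-v_i\})=\frac{1}{d+1}$ for every $i=0,\ldots,d$. $\operatorname{argmax}_{\mathcal{P}(\mathbf{S}^d)}E_\alpha$ is the set of all maximizers of $E_\alpha$ over $\mathcal{P}(\mathbf{S}^d)$. The threshold exponent $\alpha_{\Delta^d}$ is the unique element of $[1,\infty]$ such that $0<\alpha<\alpha_{\Delta^d}$ implies $\mathcal{P}_\Delta^=(\mathbf{S}^d)\cap\operatorname{argmax}_{\mathcal{P}(\mathbf{S}^d)}E_\alpha=\emptyset$, while $\alpha>\alpha_{\Delta^d}$ implies $\mathcal{P}_\Delta^=(\mathbf{S}^d)=\operatorname{argmax}_{\mathcal{P}(\mathbf{S}^d)}E_\alpha$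 (existence and uniqueness of such an exponent hold). *)

theory Defs
  imports "HOL-Probability.Probability"
begin

(* The sphere S^d lives in R^(d+1), rendered as real^'n with CARD('n) = d + 1. *)

definition prob_measures_sphere :: "(real^'n) measure set" where
  "prob_measures_sphere =
     {\<mu>. prob_space \<mu> \<and> sets \<mu> = sets (restrict_space borel (sphere 0 1))}"

definition geodesic_dist :: "real^'n \<Rightarrow> real^'n \<Rightarrow> real" where
  "geodesic_dist x y = arccos (x \<bullet> y)"

definition Lam :: "real^'n \<Rightarrow> real^'n \<Rightarrow> real" where
  "Lam x y = 2 / pi * min (geodesic_dist x y) (pi - geodesic_dist x y)"

(* Exponents range over (0, \<infinity>] in ereal; values for exponents \<le> 0 are never used. *)
definition Lam_pow :: "ereal \<Rightarrow> real^'n \<Rightarrow> real^'n \<Rightarrow> real" where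
  "Lam_pow \<alpha> x y =
     (if \<alpha> = \<infinity> then (if x \<bullet> y = 0 then 1 else 0)
      else Lam x y powr real_of_ereal \<alpha>)"

definition energy :: "ereal \<Rightarrow> (real^'n) measure \<Rightarrow> real" where
  "energy \<alpha> \<mu> = 1 / 2 * (\<integral>x. (\<integral>y. Lam_pow \<alpha> x y \<partial>\<mu>) \<partial>\<mu>)"

definition argmax_energy :: "ereal \<Rightarrow> (real^'n) measure set" where
  "argmax_energy \<alpha> = {\<mu>. is_arg_max (energy \<alpha>) (\<lambda>\<nu>. \<nu> \<in> prob_measures_sphere) \<mu>}"

definition orthonormal_basis :: "(real^'n) set \<Rightarrow> bool" where
  "orthonormal_basis B \<longleftrightarrow>
     pairwise orthogonal B \<and> (\<forall>v\<in>B. norm v = 1) \<and> span B = UNIV"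

definition P_Delta_eq :: "(real^'n) measure set" where
  "P_Delta_eq =
     {\<mu> \<in> prob_measures_sphere.
        \<exists>B. orthonormal_basis B \<and> (\<forall>v\<in>B. measure \<mu> {v, -v} = 1 / real CARD('n))}"

definition is_threshold_exponent :: "'n::finite itself \<Rightarrow> ereal \<Rightarrow> bool" where
  "is_threshold_exponent _ a \<longleftrightarrow>
     a \<in> {1..\<infinity>} \<and>
     (\<forall>\<alpha>. 0 < \<alpha> \<and> \<alpha> < a \<longrightarrow>
        (P_Delta_eq :: (real^'n) measure set) \<inter> argmax_energy \<alpha> = {}) \<and>
     (\<forall>\<alpha>>a. (P_Delta_eq :: (real^'n) measure set) = argmax_energy \<alpha>)"

definition threshold_exponent :: "'n::finite itself \<Rightarrow> ereal" where
  "threshold_exponent T = (THE a. is_threshold_exponent T a)"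

end

theory Submission
  imports Defs
begin

text \<open>Write \<open>n = d + 1\<close> and \<open>t = x \<bullet> y\<close>. At exponent \<open>2\<close> the bound \<open>\<Lambda>\<^sup>2 \<le> 1 - t\<^sup>2\<close> and the frame
  potential inequality \<open>\<integral>\<integral> t\<^sup>2 \<ge> 1/n\<close> give the maximum \<open>1 - 1/n\<close>. To descend to \<open>2 - k\<close>, sharpen this to
  \<open>\<Lambda> powr (2 - k) \<le> 1 - t\<^sup>2 - p / 4 + k e\<close> with \<open>p = \<bar>t\<bar> (1 - t\<^sup>2)\<close> and \<open>e = \<bar>t\<bar> sqrt (2 - 2 \<bar>t\<bar>)\<close>.
  For measures that are far from isotropic, the gain in the frame potential absorbs the error \<open>k e\<close>.
  Otherwise \<open>\<bar>x - x'\<bar>\<^sup>2 / n\<close> is comparable to \<open>\<integral> ((x - x') \<bullet> y)\<^sup>2 d\<mu>(y)\<close>, and a three-point inequality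
  bounds the integrand by values of \<open>p\<close>, so that \<open>\<integral>\<integral> e \<le> C n \<integral>\<integral> p\<close>. Since \<open>\<Lambda> \<le> 1\<close>, optimality of
  the simplex measures passes to all larger exponents, with uniqueness, and the threshold is the infimum
  of the exponents for which it holds. Below exponent \<open>1\<close> it fails, as splitting one of the
  point masses gains more than it loses.\<close>

section \<open>Pointwise estimates\<close>

text \<open>The function \<Lambda> in terms of the inner product. Truncating at \<open>1\<close>
  keeps the argument of \<open>arccos\<close> in its domain for every real \<open>t\<close>, so
  bounds and measurability hold without side conditions.\<close>

definition lam :: "real \<Rightarrow> real" where
  "lam t = 2 / pi * arccos (min 1 \<bar>t\<bar>)"

definition lam_pow :: "ereal \<Rightarrow> real \<Rightarrow> real" where
  "lam_pow \<alpha> t =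
     (if \<alpha> = \<infinity> then (if t = 0 then 1 else 0) else lam t powr real_of_ereal \<alpha>)"

lemma inner_unit_bounds:
  fixes x y :: "'a::real_inner"
  assumes "norm x = 1" "norm y = 1"
  shows "\<bar>x \<bullet> y\<bar> \<le> 1"
  using Cauchy_Schwarz_ineq2[of x y] assms by simp

lemma min_arccos_abs:
  assumes "\<bar>t\<bar> \<le> 1"
  shows "min (arccos t) (pi - arccos t) = arccos \<bar>t\<bar>"
proof -
  have *: "arccos \<bar>t\<bar> \<le> pi / 2" using arccos_le_pi2[of "\<bar>t\<bar>"] assms by simp
  show ?thesis
  proof (cases "t \<ge> 0")
    case True
    then show ?thesis using * by simp
  next
    case False
    then have "arccos (- t) = pi - arccos t" using arccos_minus[of t] assms by simp
    then show ?thesis using * False by simp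
  qed
qed

lemma Lam_pow_eq:
  assumes "norm x = 1" "norm y = 1"
  shows "Lam_pow \<alpha> x y = lam_pow \<alpha> (x \<bullet> y)"
  using min_arccos_abs[OF inner_unit_bounds[OF assms]] inner_unit_bounds[OF assms]
  by (simp add: Lam_pow_def lam_pow_def Lam_def lam_def geodesic_dist_def min_absorb2)

lemma lam_bounds: "0 \<le> lam t" "lam t \<le> 1"
proof -
  have "0 \<le> arccos (min 1 \<bar>t\<bar>)" "arccos (min 1 \<bar>t\<bar>) \<le> pi / 2"
    using arccos_lbound[of "min 1 \<bar>t\<bar>"] arccos_le_pi2[of "min 1 \<bar>t\<bar>"] by (auto simp: min_def)
  then show "0 \<le> lam t" "lam t \<le> 1"
    by (auto simp: lam_def field_simps)
qed

lemma lam_0 [simp]: "lam 0 = 1"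
  by (simp add: lam_def)

lemma lam_1 [simp]: "\<bar>t\<bar> = 1 \<Longrightarrow> lam t = 0"
  by (simp add: lam_def)

lemma lam_cos:
  assumes "0 \<le> \<theta>" "\<theta> \<le> pi / 2"
  shows "lam (cos \<theta>) = 2 / pi * \<theta>"
  using assms cos_ge_zero[of \<theta>] by (simp add: lam_def arccos_cos min_absorb2)

lemma lam_eq_1_iff: "\<bar>t\<bar> \<le> 1 \<Longrightarrow> lam t = 1 \<longleftrightarrow> t = 0"
proof
  assume t: "\<bar>t\<bar> \<le> 1" and "lam t = 1"
  then have "arccos \<bar>t\<bar> = pi / 2" by (simp add: lam_def min_absorb2 field_simps)
  then have "cos (arccos \<bar>t\<bar>) = 0" by (simp only: cos_pi_half)
  then show "t = 0" using t by (simp add: cos_arccos_abs)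
qed simp

lemma lam_eq_0_iff: "\<bar>t\<bar> \<le> 1 \<Longrightarrow> lam t = 0 \<longleftrightarrow> \<bar>t\<bar> = 1"
proof
  assume t: "\<bar>t\<bar> \<le> 1" and "lam t = 0"
  then have "arccos \<bar>t\<bar> = 0" by (simp add: lam_def min_absorb2 field_simps)
  then have "cos (arccos \<bar>t\<bar>) = 1" by simp
  then show "\<bar>t\<bar> = 1" using t by (simp add: cos_arccos_abs)
qed simp

lemma lam_pow_bounds: "0 \<le> lam_pow \<alpha> t" "0 < \<alpha> \<Longrightarrow> lam_pow \<alpha> t \<le> 1"
  using lam_bounds[of t] powr_mono2[of "real_of_ereal \<alpha>" "lam t" 1]
  by (cases \<alpha>; auto simp: lam_pow_def)+

lemma lam_pow_measurable [measurable]: "lam_pow \<alpha> \<in> borel_measurable borel"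
proof -
  have "continuous_on UNIV (arccos \<circ> (\<lambda>t::real. min 1 \<bar>t\<bar>))"
    by (intro continuous_on_compose continuous_intros continuous_on_subset[OF continuous_on_arccos'])
       auto
  then have [measurable]: "(\<lambda>t::real. arccos (min 1 \<bar>t\<bar>)) \<in> borel_measurable borel"
    by (auto simp: o_def intro: borel_measurable_continuous_onI)
  show ?thesis
    unfolding lam_pow_def[abs_def] lam_def by measurable
qed

text \<open>All powers of \<open>0\<close> and of \<open>1\<close> agree, and the kernel at exponent
  \<infinity> fits because \<open>lam t = 1\<close> only at \<open>t = 0\<close>. Simplex measures
  see only these two values.\<close>

lemma lam_pow_01:
  assumes "0 < \<alpha>" "\<bar>t\<bar> \<le> 1" "lam t = 0 \<or> lam t = 1"
  shows "lam_pow \<alpha> t = lam t"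
  using assms by (cases \<alpha>) (auto simp: lam_pow_def lam_eq_1_iff)

text \<open>Raising a base in the unit interval to a larger power lowers it, strictly unless the
  base is \<open>0\<close> or \<open>1\<close>. The equality case is the source of uniqueness of the
  maximizers.\<close>

lemma lam_pow_antimono:
  assumes "0 < \<alpha>" "\<alpha> < \<beta>" "\<bar>t\<bar> \<le> 1"
  shows "lam_pow \<beta> t \<le> lam_pow \<alpha> t"
    and "lam_pow \<beta> t = lam_pow \<alpha> t \<Longrightarrow> lam t = 0 \<or> lam t = 1"
proof -
  obtain r where r: "\<alpha> = ereal r" "0 < r" using assms by (cases \<alpha>) auto
  have "lam_pow \<beta> t \<le> lam_pow \<alpha> t \<and>
    (lam_pow \<beta> t = lam_pow \<alpha> t \<longrightarrow> lam t = 0 \<or> lam t = 1)"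
  proof (cases "lam t = 0 \<or> lam t = 1")
    case True
    then show ?thesis using assms lam_pow_01[of \<alpha> t] lam_pow_01[of \<beta> t] by auto
  next
    case False
    then have l: "0 < lam t" "lam t < 1" using lam_bounds[of t] by auto
    then have "t \<noteq> 0" by auto
    then show ?thesis using assms r l powr_less_mono'[OF l, of r] by (cases \<beta>) (fastforce simp: lam_pow_def)+
  qed
  then show "lam_pow \<beta> t \<le> lam_pow \<alpha> t"
    "lam_pow \<beta> t = lam_pow \<alpha> t \<Longrightarrow> lam t = 0 \<or> lam t = 1" by auto
qed

text \<open>The defect in Jordan's inequality; concavity needs the constant to be at most \<open>1/4\<close>.\<close>

lemma jordan_improved:
  assumes "0 \<le> \<theta>" "\<theta> \<le> pi / 2"
  shows "2 / pi * \<theta> \<le> sin \<theta> * (1 - cos \<theta> / 4)"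
proof -
  define g where "g x = sin x - sin x * cos x / 4 - 2 / pi * x" for x :: real
  have "concave_on {0..pi/2} g"
  proof (rule f''_le0_imp_concave)
    fix x :: real assume x: "x \<in> {0..pi/2}"
    show "(g has_real_derivative (cos x - cos x * cos x / 4 + sin x * sin x / 4 - 2 / pi)) (at x)"
      unfolding g_def by (auto intro!: derivative_eq_intros simp: field_simps)
    show "((\<lambda>x. cos x - cos x * cos x / 4 + sin x * sin x / 4 - 2 / pi)
       has_real_derivative (- sin x * (1 - cos x))) (at x)"
      by (auto intro!: derivative_eq_intros simp: field_simps)
    show "- sin x * (1 - cos x) \<le> 0"
      using x sin_ge_zero[of x] by (auto intro!: mult_nonneg_nonneg)
  qed auto
  \<comment> \<open>\<open>g\<close> vanishes at both ends of the interval, so concavity makes it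
    nonnegative in between.\<close>
  then have "(1 - \<theta> / (pi/2)) * g 0 + \<theta> / (pi/2) * g (pi/2)
      \<le> g ((1 - \<theta> / (pi/2)) *\<^sub>R 0 + (\<theta> / (pi/2)) *\<^sub>R (pi/2))"
    using assms by (intro concave_onD) (auto simp: field_simps)
  then show ?thesis by (simp add: g_def algebra_simps)
qed

text \<open>The penalty \<open>\<bar>t\<bar> (1 - t\<^sup>2)\<close> vanishes exactly where \<open>t \<in> {0, 1, -1}\<close>; the error
  \<open>\<bar>t\<bar> sqrt (2 - 2 \<bar>t\<bar>)\<close> has the same zeros but dominates the penalty near \<open>\<bar>t\<bar> = 1\<close>.\<close>

lemma lam_powr_le:
  assumes t: "\<bar>t\<bar> \<le> 1" and k: "0 \<le> k" "k < 1"
  shows "lam_pow (ereal (2 - k)) t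
    \<le> 1 - t\<^sup>2 - (\<bar>t\<bar> * (1 - t\<^sup>2)) / 4 + k * (\<bar>t\<bar> * sqrt (2 - 2 * \<bar>t\<bar>))"
proof -
  define \<theta> where "\<theta> = arccos \<bar>t\<bar>"
  have \<theta>: "0 \<le> \<theta>" "\<theta> \<le> pi / 2"
    using t arccos_lbound[of "\<bar>t\<bar>"] arccos_le_pi2[of "\<bar>t\<bar>"] by (auto simp: \<theta>_def)
  have cos: "cos \<theta> = \<bar>t\<bar>" and sin: "sin \<theta> = sqrt (1 - t\<^sup>2)"
    using t by (auto simp: \<theta>_def cos_arccos_abs sin_arccos_abs)
  define u where "u = lam t"
  have u: "0 \<le> u" "u \<le> 1" using lam_bounds[of t] by (auto simp: u_def)
  have u_eq: "u = 2 / pi * \<theta>" using t by (simp add: u_def lam_def \<theta>_def min_absorb2)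
  define s where "s = sqrt (1 - t\<^sup>2)"
  have t2: "t\<^sup>2 \<le> 1" using t by (simp add: abs_square_le_1)
  have s0: "0 \<le> s" using t2 by (simp add: s_def)
  have s2: "s\<^sup>2 = 1 - t\<^sup>2" using t2 by (simp add: s_def)
  have us: "u \<le> s * (1 - \<bar>t\<bar> / 4)"
    using jordan_improved[OF \<theta>] by (simp add: u_eq cos sin s_def)
  also have "\<dots> \<le> s * 1" using s0 by (intro mult_left_mono) auto
  finally have us': "u \<le> s" by simp
  \<comment> \<open>Jordan's inequality for the complementary angle bounds \<open>1 - u\<close> by
    \<open>\<bar>t\<bar>\<close>, so that the error term also vanishes at orthogonal pairs.\<close>
  have "2 / pi * (pi / 2 - \<theta>) \<le> sin (pi / 2 - \<theta>) * (1 - cos (pi / 2 - \<theta>) / 4)"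
    using \<theta> by (intro jordan_improved) auto
  also have "\<dots> \<le> sin (pi / 2 - \<theta>) * 1"
    using \<theta> sin_ge_zero[of \<theta>] cos by (intro mult_left_mono) (auto simp: sin_diff cos_diff)
  finally have ut: "1 - u \<le> \<bar>t\<bar>"
    using cos by (simp add: sin_diff u_eq algebra_simps)
  have ss: "s \<le> sqrt (2 - 2 * \<bar>t\<bar>)"
  proof -
    have "1 - t\<^sup>2 = (1 - \<bar>t\<bar>) * (1 + \<bar>t\<bar>)" by (simp add: power2_eq_square algebra_simps)
    also have "\<dots> \<le> (1 - \<bar>t\<bar>) * 2" using t by (intro mult_left_mono) auto
    finally show ?thesis unfolding s_def by (intro real_sqrt_le_mono) auto
  qed
  have "lam_pow (ereal (2 - k)) t = u powr (2 - k)"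
    by (simp add: lam_pow_def u_def)
  \<comment> \<open>Weighted AM-GM applied to \<open>u powr (1 - k) * 1 powr k\<close>.\<close>
  also have "\<dots> \<le> u\<^sup>2 + k * (u * (1 - u))"
  proof (cases "u = 0")
    case False
    then have "u powr (2 - k) = u * (u powr (1 - k) * 1 powr k)"
      using u by (simp add: powr_mult_base)
    also have "\<dots> \<le> u * ((1 - k) * u + k * 1)"
      using u False k by (intro mult_left_mono Youngs_inequality_0) auto
    finally show ?thesis using u by (simp add: power2_eq_square algebra_simps)
  qed simp
  also have "k * (u * (1 - u)) \<le> k * (sqrt (2 - 2 * \<bar>t\<bar>) * \<bar>t\<bar>)"
    using us' ut ss u s0 t k by (intro mult_left_mono mult_mono) auto
  \<comment> \<open>Here the improved Jordan inequality is used in full; one of the two factors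
    \<open>1 - \<bar>t\<bar> / 4\<close> is enough and the other is bounded by
    \<open>1\<close>.\<close>
  also have "u\<^sup>2 \<le> 1 - t\<^sup>2 - \<bar>t\<bar> * (1 - t\<^sup>2) / 4"
  proof -
    have "u\<^sup>2 \<le> (s * (1 - \<bar>t\<bar> / 4))\<^sup>2" using us u by (intro power_mono) auto
    also have "\<dots> = s\<^sup>2 * ((1 - \<bar>t\<bar> / 4) * (1 - \<bar>t\<bar> / 4))" by (simp add: power2_eq_square)
    also have "\<dots> \<le> s\<^sup>2 * ((1 - \<bar>t\<bar> / 4) * 1)"
      using t by (intro mult_left_mono) auto
    finally show ?thesis by (simp add: s2 algebra_simps)
  qed
  finally show ?thesis by (simp add: mult.commute)
qed

text \<open>Nonnegativity of the Gram determinant of three unit vectors.\<close>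

lemma gram3:
  fixes x x' y :: "'a::real_inner"
  assumes "norm x = 1" "norm x' = 1" "norm y = 1"
  shows "(x \<bullet> y)\<^sup>2 + (x' \<bullet> y)\<^sup>2 + (x \<bullet> x')\<^sup>2
    \<le> 1 + 2 * (x \<bullet> x') * (x \<bullet> y) * (x' \<bullet> y)"
proof -
  have 1: "x \<bullet> x = 1" "x' \<bullet> x' = 1" "y \<bullet> y = 1" using assms by (simp_all add: dot_square_norm)
  \<comment> \<open>\<open>p\<close> and \<open>q\<close> are the components of \<open>y\<close> and
    \<open>x'\<close> orthogonal to \<open>x\<close>; the claim is Cauchy-Schwarz for them.\<close>
  define p q where "p = y - (x \<bullet> y) *\<^sub>R x" and "q = x' - (x \<bullet> x') *\<^sub>R x"
  have "p \<bullet> q = x' \<bullet> y - (x \<bullet> y) * (x \<bullet> x')"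
    by (simp add: p_def q_def inner_diff_left inner_diff_right 1 inner_commute)
  moreover have "p \<bullet> p = 1 - (x \<bullet> y)\<^sup>2"
    by (simp add: p_def inner_diff_left inner_diff_right 1 inner_commute power2_eq_square)
  moreover have "q \<bullet> q = 1 - (x \<bullet> x')\<^sup>2"
    by (simp add: q_def inner_diff_left inner_diff_right 1 inner_commute power2_eq_square)
  moreover have "(p \<bullet> q)\<^sup>2 \<le> (p \<bullet> p) * (q \<bullet> q)" by (rule Cauchy_Schwarz_ineq)
  ultimately have "(x' \<bullet> y - (x \<bullet> y) * (x \<bullet> x'))\<^sup>2 \<le> (1 - (x \<bullet> y)\<^sup>2) * (1 - (x \<bullet> x')\<^sup>2)"
    by simp
  then show ?thesis by (simp add: power2_eq_square algebra_simps)
qed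

definition pen :: "real \<Rightarrow> real" where "pen t = \<bar>t\<bar> * (1 - t\<^sup>2)"

lemma pen_bounds: "\<bar>t\<bar> \<le> 1 \<Longrightarrow> 0 \<le> pen t" "\<bar>t\<bar> \<le> 1 \<Longrightarrow> pen t \<le> 1"
proof -
  assume "\<bar>t\<bar> \<le> 1"
  then have "t\<^sup>2 \<le> 1" by (simp add: abs_square_le_1)
  then show "0 \<le> pen t" "pen t \<le> 1" using \<open>\<bar>t\<bar> \<le> 1\<close>
    by (auto simp: pen_def intro!: mult_le_one)
qed

lemma pen_minus [simp]: "pen (- t) = pen t" by (simp add: pen_def)

lemma pen_ge:
  assumes "\<bar>t\<bar> \<le> 4/5"
  shows "9/25 * \<bar>t\<bar> \<le> pen t"
proof -
  have "\<bar>t\<bar> * \<bar>t\<bar> \<le> 4/5 * (4/5)" using assms by (intro mult_mono) auto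
  then have "t\<^sup>2 \<le> 16/25" by (simp add: power2_eq_square)
  then have "\<bar>t\<bar> * (9/25) \<le> \<bar>t\<bar> * (1 - t\<^sup>2)" by (intro mult_left_mono) auto
  then show ?thesis by (simp add: pen_def)
qed

text \<open>If \<open>t\<close> and \<open>a\<close> are both at least \<open>4/5\<close>, the triangle inequality for angles forces
  \<open>b \<ge> 7/25\<close>, the cosine of twice the angle with cosine \<open>4/5\<close>.\<close>

lemma three_point_near:
  fixes t a b :: real
  assumes gram: "a\<^sup>2 + b\<^sup>2 + t\<^sup>2 \<le> 1 + 2 * t * a * b"
    and t: "4/5 \<le> t" "t \<le> 1" and a: "4/5 \<le> a" "a \<le> 1" and b: "\<bar>b\<bar> \<le> 1"
  shows "(a - b)\<^sup>2 \<le> 25/7 * (2 - 2 * t) * (pen a + pen b)"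
proof -
  have "(b - a * t)\<^sup>2 \<le> (1 - a\<^sup>2) * (1 - t\<^sup>2)"
    using gram by (simp add: power2_eq_square algebra_simps)
  also have "\<dots> \<le> (9/25) * (9/25)"
  proof (rule mult_mono)
    have "4/5 * (4/5) \<le> a * a" "4/5 * (4/5) \<le> t * t" "t * t \<le> 1 * 1"
      using t a by (intro mult_mono; simp)+
    then show "1 - a\<^sup>2 \<le> 9/25" "1 - t\<^sup>2 \<le> 9/25" "0 \<le> 1 - t\<^sup>2"
      by (auto simp: power2_eq_square)
  qed auto
  finally have "\<bar>b - a * t\<bar> \<le> 9/25"
    using abs_le_square_iff[of "b - a * t" "9/25"] by (simp add: power2_eq_square)
  moreover have "4/5 * (4/5) \<le> a * t" using t a by (intro mult_mono) auto
  ultimately have b7: "7/25 \<le> b" by linarith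
  have a2: "a\<^sup>2 \<le> 1" "b\<^sup>2 \<le> 1" using a b by (auto simp: abs_square_le_1)
  have pa: "7/25 * (1 - a\<^sup>2) \<le> pen a" unfolding pen_def
    using a a2 by (intro mult_right_mono) auto
  have pb: "7/25 * (1 - b\<^sup>2) \<le> pen b" unfolding pen_def
    using b7 a2 by (intro mult_right_mono) auto
  \<comment> \<open>The defect \<open>1 - c\<^sup>2\<close> at the mean \<open>c\<close> of
    \<open>a\<close> and \<open>b\<close> is at most the defect at the smaller of the two, hence at
    most the sum of both defects.\<close>
  have m: "(min a b)\<^sup>2 \<le> ((a + b) / 2)\<^sup>2" using a b7 by (intro power_mono) (auto simp: min_def)
  have "(min a b)\<^sup>2 \<ge> a\<^sup>2 + b\<^sup>2 - 1" using a2 by (auto simp: min_def)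
  then have "1 - ((a + b) / 2)\<^sup>2 \<le> (1 - a\<^sup>2) + (1 - b\<^sup>2)" using m by linarith
  also have "\<dots> \<le> 25/7 * (pen a + pen b)" using pa pb by simp
  finally have 1: "1 - ((a + b) / 2)\<^sup>2 \<le> 25/7 * (pen a + pen b)" .
  \<comment> \<open>Four times the Gram inequality. With \<open>t\<close>, \<open>a\<close>,
    \<open>b\<close> the inner products of \<open>x\<close>, \<open>x'\<close>, \<open>y\<close>, it
    is Bessel's inequality for the orthogonal vectors \<open>x - x'\<close> and
    \<open>x + x'\<close>, whose squared norms are \<open>2 - 2 * t\<close> and
    \<open>2 + 2 * t\<close>.\<close>
  have "(a - b)\<^sup>2 * (2 + 2 * t) + (a + b)\<^sup>2 * (2 - 2 * t) \<le> (2 - 2 * t) * (2 + 2 * t)"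
    using gram by (simp add: power2_eq_square algebra_simps)
  then have "(a - b)\<^sup>2 * (2 + 2 * t) \<le> (2 - 2 * t) * ((2 + 2 * t) - (a + b)\<^sup>2)"
    by (simp add: algebra_simps)
  also have "\<dots> \<le> (2 - 2 * t) * ((2 + 2 * t) * (1 - ((a + b) / 2)\<^sup>2))"
  proof (rule mult_left_mono)
    have "(2 + 2 * t) * ((a + b)\<^sup>2 / 4) \<le> 4 * ((a + b)\<^sup>2 / 4)"
      using t by (intro mult_right_mono) auto
    then show "(2 + 2 * t) - (a + b)\<^sup>2 \<le> (2 + 2 * t) * (1 - ((a + b) / 2)\<^sup>2)"
      by (simp add: power_divide algebra_simps)
  qed (use t in auto)
  finally have "(2 + 2 * t) * (a - b)\<^sup>2
      \<le> (2 + 2 * t) * ((2 - 2 * t) * (1 - ((a + b) / 2)\<^sup>2))" by (simp add: mult_ac)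
  then have "(a - b)\<^sup>2 \<le> (2 - 2 * t) * (1 - ((a + b) / 2)\<^sup>2)" using t by simp
  also have "\<dots> \<le> (2 - 2 * t) * (25/7 * (pen a + pen b))"
    using t 1 by (intro mult_left_mono) auto
  finally show ?thesis by (simp only: mult_ac)
qed

text \<open>For \<open>t \<le> 4/5\<close> the term \<open>pen t\<close> alone controls
  \<open>t\<close>. For larger \<open>t\<close>, either \<open>a\<close> and \<open>b\<close> are
  both at most \<open>4/5\<close> in modulus and their penalties control
  \<open>\<bar>a - b\<bar>\<close>, or one is close to \<open>1\<close> or \<open>-1\<close> and
  \<open>three_point_near\<close> applies after a swap or a sign change. The constant
  \<open>6\<close> dominates the resulting \<open>50/9\<close>, \<open>25/9\<close> and
  \<open>25/7\<close>.\<close>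

lemma three_point:
  fixes t a b :: real
  assumes gram: "a\<^sup>2 + b\<^sup>2 + t\<^sup>2 \<le> 1 + 2 * t * a * b"
    and t: "0 \<le> t" "t \<le> 1" and a: "\<bar>a\<bar> \<le> 1" and b: "\<bar>b\<bar> \<le> 1"
  shows "t * (a - b)\<^sup>2 \<le> 6 * sqrt (2 - 2 * t) * (pen a + pen b + pen t)"
proof -
  define r where "r = sqrt (2 - 2 * t)"
  have r0: "0 \<le> r" and r2: "r\<^sup>2 = 2 - 2 * t" using t by (auto simp: r_def)
  have P: "0 \<le> pen a" "0 \<le> pen b" "0 \<le> pen t" using pen_bounds t a b by auto
  have "(a - b)\<^sup>2 * (2 + 2 * t) + (a + b)\<^sup>2 * (2 - 2 * t) \<le> (2 - 2 * t) * (2 + 2 * t)"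
    using gram by (simp add: power2_eq_square algebra_simps)
  moreover have "0 \<le> (a + b)\<^sup>2 * (2 - 2 * t)" using t by simp
  ultimately have "(a - b)\<^sup>2 * (2 + 2 * t) \<le> r\<^sup>2 * (2 + 2 * t)" by (simp add: r2)
  then have "(a - b)\<^sup>2 \<le> r\<^sup>2" using t by simp
  then have ab: "\<bar>a - b\<bar> \<le> r" using r0 by (simp add: abs_le_square_iff[of "a - b" r, symmetric])
  have ab2: "(a - b)\<^sup>2 \<le> r * \<bar>a - b\<bar>"
    using mult_right_mono[OF ab, of "\<bar>a - b\<bar>"] by (simp add: power2_eq_square)
  have far: "x * t \<le> x" if "0 \<le> x" for x :: real using that t by (simp add: mult_left_le)
  have "t * (a - b)\<^sup>2 \<le> r * (6 * (pen a + pen b + pen t))"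
  proof (cases "t \<le> 4/5")
    case True
    have "t * (a - b)\<^sup>2 \<le> t * (r * \<bar>a - b\<bar>)" using ab2 t by (intro mult_left_mono)
    also have "\<dots> \<le> t * (r * 2)" using a b t r0 by (intro mult_left_mono) auto
    also have "\<dots> = r * (2 * t)" by simp
    also have "\<dots> \<le> r * (6 * (pen a + pen b + pen t))"
      using pen_ge[of t] True t P r0 by (intro mult_left_mono) auto
    finally show ?thesis .
  next
    case False
    then have t4: "4/5 \<le> t" by simp
    have r1: "r \<le> 1" unfolding r_def using t4 by simp
    have near: "25/7 * (2 - 2 * t) * (pen a + pen b) \<le> r * (6 * (pen a + pen b + pen t))"
    proof -
      have "r * (r * (25/7 * (pen a + pen b))) \<le> r * (1 * (25/7 * (pen a + pen b)))"
        using r0 r1 P by (intro mult_left_mono mult_right_mono) auto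
      also have "\<dots> \<le> r * (6 * (pen a + pen b + pen t))"
        using r0 P by (intro mult_left_mono) auto
      finally have "r\<^sup>2 * (25/7 * (pen a + pen b)) \<le> r * (6 * (pen a + pen b + pen t))"
        by (simp add: power2_eq_square)
      then show ?thesis unfolding r2 by (simp only: mult_ac)
    qed
    have le: "t * (a - b)\<^sup>2 \<le> (a - b)\<^sup>2" using far[of "(a - b)\<^sup>2"] by (simp add: mult.commute)
    consider "\<bar>a\<bar> \<le> 4/5" "\<bar>b\<bar> \<le> 4/5" | "4/5 \<le> a" | "4/5 \<le> - a" | "4/5 \<le> b" | "4/5 \<le> - b"
      by linarith
    then show ?thesis
    proof cases
      case 1
      have "(a - b)\<^sup>2 \<le> r * \<bar>a - b\<bar>" by (rule ab2)
      also have "\<dots> \<le> r * (6 * (pen a + pen b + pen t))"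
        using pen_ge[OF 1(1)] pen_ge[OF 1(2)] P r0 by (intro mult_left_mono) auto
      finally show ?thesis using le by simp
    next
      case 2
      have "a \<le> 1" using a by simp
      then show ?thesis using three_point_near[OF gram t4 t(2) 2 _ b] near le by linarith
    next
      case 3
      have "(- a - - b)\<^sup>2 \<le> 25/7 * (2 - 2 * t) * (pen (- a) + pen (- b))"
        using gram 3 a b t4 t by (intro three_point_near) auto
      moreover have "(- a - - b)\<^sup>2 = (a - b)\<^sup>2" by (simp add: power2_eq_square algebra_simps)
      ultimately show ?thesis using near le by simp
    next
      case 4
      have "(b - a)\<^sup>2 \<le> 25/7 * (2 - 2 * t) * (pen b + pen a)"
        using gram 4 a b t4 t by (intro three_point_near) (auto simp: algebra_simps)
      moreover have "(b - a)\<^sup>2 = (a - b)\<^sup>2" by (simp add: power2_eq_square algebra_simps)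
      ultimately show ?thesis using near le by (simp add: add.commute)
    next
      case 5
      have "(- b - - a)\<^sup>2 \<le> 25/7 * (2 - 2 * t) * (pen (- b) + pen (- a))"
        using gram 5 a b t4 t by (intro three_point_near) (auto simp: algebra_simps)
      moreover have "(- b - - a)\<^sup>2 = (a - b)\<^sup>2" by (simp add: power2_eq_square algebra_simps)
      ultimately show ?thesis using near le by (simp add: add.commute)
    qed
  qed
  then show ?thesis by (simp only: r_def mult_ac)
qed

section \<open>Zonal energies and the frame potential\<close>

text \<open>The bound is demanded only where inner products of unit vectors lie, so unbounded
  kernels such as \<open>t\<^sup>2\<close> qualify and are still integrable on the sphere.\<close>

definition tame :: "(real \<Rightarrow> real) \<Rightarrow> bool" where
  "tame f \<longleftrightarrow> f \<in> borel_measurable borel \<and> (\<exists>C. \<forall>t. \<bar>t\<bar> \<le> 1 \<longrightarrow> \<bar>f t\<bar> \<le> C)"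

lemma tameI:
  assumes "f \<in> borel_measurable borel" "\<And>t. \<bar>t\<bar> \<le> 1 \<Longrightarrow> \<bar>f t\<bar> \<le> C"
  shows "tame f"
  using assms by (auto simp: tame_def)

lemma tame_const: "tame (\<lambda>t. c)"
  by (rule tameI[where C = "\<bar>c\<bar>"]) auto

lemma tame_add:
  assumes "tame f" "tame g"
  shows "tame (\<lambda>t. f t + g t)"
proof -
  obtain C D where [measurable]: "f \<in> borel_measurable borel" "g \<in> borel_measurable borel"
    and C: "\<And>t. \<bar>t\<bar> \<le> 1 \<Longrightarrow> \<bar>f t\<bar> \<le> C" "\<And>t. \<bar>t\<bar> \<le> 1 \<Longrightarrow> \<bar>g t\<bar> \<le> D"
    using assms unfolding tame_def by blast
  show ?thesis
    by (rule tameI[where C = "C + D"]) (auto intro!: order_trans[OF abs_triangle_ineq add_mono] C)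
qed

lemma tame_cmult:
  assumes "tame f"
  shows "tame (\<lambda>t. c * f t)"
proof -
  obtain C where [measurable]: "f \<in> borel_measurable borel"
    and C: "\<And>t. \<bar>t\<bar> \<le> 1 \<Longrightarrow> \<bar>f t\<bar> \<le> C"
    using assms unfolding tame_def by blast
  show ?thesis
    by (rule tameI[where C = "\<bar>c\<bar> * C"]) (auto simp: abs_mult intro!: mult_left_mono C)
qed

lemma tame_diff: "tame f \<Longrightarrow> tame g \<Longrightarrow> tame (\<lambda>t. f t - g t)"
  using tame_add[of f "\<lambda>t. - 1 * g t"] tame_cmult[of g "-1"] by simp

lemma tame_power2: "tame (\<lambda>t. t\<^sup>2)"
  by (rule tameI[where C = 1]) (auto simp: abs_square_le_1)

lemma tame_pen: "tame pen"
proof (rule tameI)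
  show "pen \<in> borel_measurable borel" by (simp add: pen_def[abs_def])
qed (use pen_bounds in auto)

lemma tame_lam_pow: "0 < \<alpha> \<Longrightarrow> tame (lam_pow \<alpha>)"
  by (rule tameI[where C = 1]) (auto simp: lam_pow_bounds)

text \<open>For unit vectors with inner product \<open>t\<close>, the root is the chordal distance
  from one vector to the nearer of the other and its antipode.\<close>

definition err :: "real \<Rightarrow> real" where "err t = \<bar>t\<bar> * sqrt (2 - 2 * \<bar>t\<bar>)"

lemma err_bounds:
  assumes "\<bar>t\<bar> \<le> 1" shows "0 \<le> err t" "err t \<le> 2"
proof -
  have "sqrt (2 - 2 * \<bar>t\<bar>) \<le> sqrt 4" by (intro real_sqrt_le_mono) simp
  then have "\<bar>t\<bar> * sqrt (2 - 2 * \<bar>t\<bar>) \<le> 1 * 2" using assms by (intro mult_mono) auto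
  then show "0 \<le> err t" "err t \<le> 2" using assms by (auto simp: err_def)
qed

lemma tame_err: "tame err"
proof (rule tameI)
  show "err \<in> borel_measurable borel" by (simp add: err_def[abs_def])
qed (use err_bounds in auto)

definition zonal :: "(real \<Rightarrow> real) \<Rightarrow> (real^'n) measure \<Rightarrow> real" where
  "zonal f \<mu> = (\<integral>x. (\<integral>y. f (x \<bullet> y) \<partial>\<mu>) \<partial>\<mu>)"

locale sphere_prob = prob_space \<mu> for \<mu> :: "(real^'n) measure" +
  assumes sets_eq: "sets \<mu> = sets (restrict_space borel (sphere 0 1))"
begin

lemma space_eq: "space \<mu> = sphere 0 1"
  using sets_eq_imp_space_eq[OF sets_eq] by (simp add: space_restrict_space)

lemma norm_space: "x \<in> space \<mu> \<Longrightarrow> norm x = 1"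
  by (simp add: space_eq)

lemma borel_imp_measurable: "f \<in> borel \<rightarrow>\<^sub>M N \<Longrightarrow> f \<in> \<mu> \<rightarrow>\<^sub>M N"
  using measurable_restrict_space1[of f borel N "sphere 0 1"]
    measurable_cong_sets[OF sets_eq refl, of N] by blast

lemma id_measurable [measurable]: "(\<lambda>x. x) \<in> \<mu> \<rightarrow>\<^sub>M borel"
  by (rule borel_imp_measurable) simp

lemma pair_sets [measurable]: "{v, w} \<in> sets \<mu>" if "norm v = 1" "norm w = 1" for v w
proof -
  have "{v, w} \<in> sets borel" by (simp add: borel_closed)
  then show ?thesis using that by (auto simp: sets_eq sets_restrict_space image_iff intro!: bexI[of _ "{v, w}"])
qed

lemma tame_integrable:
  assumes "tame f" "norm x = 1"
  shows "integrable \<mu> (\<lambda>y. f (x \<bullet> y))"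
proof -
  obtain C where C: "\<And>t. \<bar>t\<bar> \<le> 1 \<Longrightarrow> \<bar>f t\<bar> \<le> C" and [measurable]: "f \<in> borel_measurable borel"
    using assms by (auto simp: tame_def)
  have m: "(\<lambda>y. f (x \<bullet> y)) \<in> borel_measurable borel" by measurable
  show ?thesis
    by (rule integrable_const_bound[of _ C])
      (auto intro!: AE_I2 C inner_unit_bounds borel_imp_measurable[OF m] simp: assms norm_space)
qed

lemma pot_integrable:
  assumes "tame f"
  shows "integrable \<mu> (\<lambda>x. \<integral>y. f (x \<bullet> y) \<partial>\<mu>)"
proof -
  obtain C where C: "\<And>t. \<bar>t\<bar> \<le> 1 \<Longrightarrow> \<bar>f t\<bar> \<le> C" and [measurable]: "f \<in> borel_measurable borel"
    using assms by (auto simp: tame_def)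
  have "(\<lambda>x. \<integral>y. f (x \<bullet> y) \<partial>\<mu>) \<in> borel_measurable \<mu>" by measurable
  moreover have "norm (\<integral>y. f (x \<bullet> y) \<partial>\<mu>) \<le> C" if "x \<in> space \<mu>" for x
  proof -
    have "\<bar>\<integral>y. f (x \<bullet> y) \<partial>\<mu>\<bar> \<le> (\<integral>y. \<bar>f (x \<bullet> y)\<bar> \<partial>\<mu>)" by (rule integral_abs_bound)
    also have "\<dots> \<le> (\<integral>y. C \<partial>\<mu>)"
    proof (rule integral_mono)
      show "integrable \<mu> (\<lambda>y. \<bar>f (x \<bullet> y)\<bar>)"
        using assms that by (intro integrable_abs tame_integrable norm_space)
    qed (use that in \<open>auto intro!: C inner_unit_bounds norm_space\<close>)
    finally show ?thesis by (simp add: prob_space)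
  qed
  ultimately show ?thesis by (intro integrable_const_bound[of _ C] AE_I2) auto
qed

lemma zonal_mono:
  assumes "tame f" "tame g" "\<And>t. \<bar>t\<bar> \<le> 1 \<Longrightarrow> f t \<le> g t"
  shows "zonal f \<mu> \<le> zonal g \<mu>"
  unfolding zonal_def using assms
  by (intro integral_mono pot_integrable tame_integrable assms(3) inner_unit_bounds norm_space) auto

lemma zonal_const: "zonal (\<lambda>t. c) \<mu> = c"
  by (simp add: zonal_def prob_space)

lemma zonal_cmult: "zonal (\<lambda>t. c * f t) \<mu> = c * zonal f \<mu>"
  by (simp add: zonal_def)

lemma zonal_add:
  assumes "tame f" "tame g"
  shows "zonal (\<lambda>t. f t + g t) \<mu> = zonal f \<mu> + zonal g \<mu>"
proof -
  have "zonal (\<lambda>t. f t + g t) \<mu> = (\<integral>x. (\<integral>y. f (x \<bullet> y) \<partial>\<mu>) + (\<integral>y. g (x \<bullet> y) \<partial>\<mu>) \<partial>\<mu>)"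
    unfolding zonal_def using assms
    by (intro Bochner_Integration.integral_cong refl Bochner_Integration.integral_add tame_integrable)
      (auto simp: norm_space)
  then show ?thesis using assms by (simp add: zonal_def pot_integrable)
qed

lemma zonal_diff:
  assumes "tame f" "tame g"
  shows "zonal (\<lambda>t. f t - g t) \<mu> = zonal f \<mu> - zonal g \<mu>"
  using zonal_add[of f "\<lambda>t. - 1 * g t"] zonal_cmult[of "-1" g] tame_cmult[of g "-1"] assms by simp

lemma zonal_eq_0D:
  assumes "tame f" "\<And>t. \<bar>t\<bar> \<le> 1 \<Longrightarrow> 0 \<le> f t" "zonal f \<mu> = 0"
  shows "AE x in \<mu>. AE y in \<mu>. f (x \<bullet> y) = 0"
proof -
  have nn: "0 \<le> f (x \<bullet> y)" if "x \<in> space \<mu>" "y \<in> space \<mu>" for x y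
    using that assms by (intro assms inner_unit_bounds norm_space)
  have "AE x in \<mu>. (\<integral>y. f (x \<bullet> y) \<partial>\<mu>) = 0"
    using assms nn by (subst integral_nonneg_eq_0_iff_AE[symmetric])
      (auto simp: zonal_def pot_integrable intro!: AE_I2 integral_nonneg_AE)
  moreover have "AE x in \<mu>. x \<in> space \<mu>" by simp
  ultimately show ?thesis
  proof eventually_elim
    case (elim x)
    then show ?case using assms nn
      by (subst integral_nonneg_eq_0_iff_AE[symmetric]) (auto simp: tame_integrable norm_space intro!: AE_I2)
  qed
qed

section \<open>The second moment matrix, the frame potential and absorption of the error\<close>

lemma component_integrable: "integrable \<mu> (\<lambda>y. y $ i * y $ j)"
proof (rule integrable_const_bound[of _ 1])
  have "\<bar>y $ i * y $ j\<bar> \<le> 1 * 1" if "y \<in> space \<mu>" for y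
    unfolding abs_mult using component_le_norm_cart[of y i] component_le_norm_cart[of y j]
      norm_space[OF that] by (intro mult_mono) auto
  then show "AE y in \<mu>. norm (y $ i * y $ j) \<le> 1" by (auto intro!: AE_I2)
  show "(\<lambda>y. y $ i * y $ j) \<in> borel_measurable \<mu>"
    by (rule borel_imp_measurable) (auto intro!: borel_measurable_continuous_onI continuous_intros)
qed

definition mom :: "'n \<Rightarrow> 'n \<Rightarrow> real" where
  "mom i j = (\<integral>y. y $ i * y $ j \<partial>\<mu>)"

lemma inner_power2_expand:
  fixes z y :: "real^'n"
  shows "(z \<bullet> y)\<^sup>2 = (\<Sum>(i,j)\<in>UNIV. (z $ i * z $ j) * (y $ i * y $ j))"
  by (simp add: inner_vec_def power2_eq_square sum_product sum.cartesian_product UNIV_Times_UNIV[symmetric] mult_ac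
      del: UNIV_Times_UNIV)

lemma quad_mom: "(\<integral>y. (z \<bullet> y)\<^sup>2 \<partial>\<mu>) = (\<Sum>(i,j)\<in>UNIV. (z $ i * z $ j) * mom i j)"
  unfolding inner_power2_expand
  by (subst Bochner_Integration.integral_sum) (auto simp: mom_def component_integrable intro!: sum.cong)

lemma zonal_power2_mom: "zonal (\<lambda>t. t\<^sup>2) \<mu> = (\<Sum>(i,j)\<in>UNIV. (mom i j)\<^sup>2)"
proof -
  have "zonal (\<lambda>t. t\<^sup>2) \<mu> = (\<integral>x. (\<Sum>(i,j)\<in>UNIV. (x $ i * x $ j) * mom i j) \<partial>\<mu>)"
    by (simp add: zonal_def quad_mom)
  also have "\<dots> = (\<Sum>(i,j)\<in>UNIV. mom i j * mom i j)"
    by (subst Bochner_Integration.integral_sum) (auto simp: mom_def component_integrable intro!: sum.cong)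
  finally show ?thesis by (simp add: power2_eq_square)
qed

lemma trace_mom: "(\<Sum>i\<in>UNIV. mom i i) = 1"
proof -
  have "(\<Sum>i\<in>UNIV. mom i i) = (\<integral>y. (\<Sum>i\<in>UNIV. y $ i * y $ i) \<partial>\<mu>)"
    by (simp add: mom_def component_integrable)
  also have "\<dots> = (\<integral>y. 1 \<partial>\<mu>)"
  proof (rule Bochner_Integration.integral_cong)
    fix y assume "y \<in> space \<mu>"
    then have "y \<bullet> y = 1" by (simp add: dot_square_norm norm_space)
    then show "(\<Sum>i\<in>UNIV. y $ i * y $ i) = 1" by (simp add: inner_vec_def)
  qed simp
  finally show ?thesis by (simp add: prob_space)
qed

text \<open>The excess of the frame potential over \<open>1/n\<close> is the squared Frobenius distance between
  the second moment matrix and \<open>I/n\<close>.\<close>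

lemma frame_bound:
  "((\<integral>y. (z \<bullet> y)\<^sup>2 \<partial>\<mu>) - (norm z)\<^sup>2 / CARD('n))\<^sup>2
    \<le> (zonal (\<lambda>t. t\<^sup>2) \<mu> - 1 / CARD('n)) * (norm z) ^ 4"
proof -
  define n where "n = real CARD('n)"
  have n0: "n > 0" by (simp add: n_def)
  define D where "D i j = (if i = j then 1 / n else 0)" for i j :: 'n
  define B where "B i j = mom i j - D i j" for i j
  have diag: "(\<Sum>(i,j)\<in>UNIV. f i j * D i j) = (\<Sum>i\<in>UNIV. f i i) / n" for f :: "'n \<Rightarrow> 'n \<Rightarrow> real"
  proof -
    have "(\<Sum>(i,j)\<in>UNIV. f i j * D i j) = (\<Sum>i\<in>UNIV. \<Sum>j\<in>UNIV. f i j * D i j)"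
      by (simp add: sum.cartesian_product)
    also have "\<dots> = (\<Sum>i\<in>UNIV. f i i / n)"
      by (simp add: D_def if_distrib[of "(*) _"] cong: if_cong)
    finally show ?thesis by (simp add: sum_divide_distrib)
  qed
  have znorm: "(\<Sum>i\<in>UNIV. z $ i * z $ i) = (norm z)\<^sup>2"
    by (simp add: power2_norm_eq_inner inner_vec_def)
  have BB: "(\<Sum>(i,j)\<in>UNIV. (B i j)\<^sup>2) = zonal (\<lambda>t. t\<^sup>2) \<mu> - 1 / n"
  proof -
    \<comment> \<open>Since \<open>mom\<close> has trace \<open>1\<close>, the cross term is
      \<open>2 / n\<close>, while \<open>D\<close> contributes \<open>1 / n\<close>.\<close>
    have "(\<Sum>(i,j)\<in>UNIV. (B i j)\<^sup>2)
        = (\<Sum>(i,j)\<in>UNIV. (mom i j)\<^sup>2) - 2 * (\<Sum>(i,j)\<in>UNIV. mom i j * D i j) + (\<Sum>(i,j)\<in>UNIV. D i j * D i j)"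
      by (simp add: B_def case_prod_unfold power2_eq_square algebra_simps sum.distrib sum_subtractf sum_distrib_left)
    also have "\<dots> = zonal (\<lambda>t. t\<^sup>2) \<mu> - 1 / n"
      using n0 by (simp add: diag trace_mom zonal_power2_mom) (simp add: D_def n_def)
    finally show ?thesis .
  qed
  have "(\<integral>y. (z \<bullet> y)\<^sup>2 \<partial>\<mu>) - (norm z)\<^sup>2 / n
      = (\<Sum>(i,j)\<in>UNIV. (z $ i * z $ j) * mom i j) - (\<Sum>(i,j)\<in>UNIV. (z $ i * z $ j) * D i j)"
    by (simp add: quad_mom diag znorm)
  also have "\<dots> = (\<Sum>(i,j)\<in>UNIV. (z $ i * z $ j) * B i j)"
    by (simp add: B_def case_prod_unfold algebra_simps sum_subtractf)
  \<comment> \<open>Cauchy-Schwarz for the Frobenius pairing of the rank-one matrix of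
    \<open>z\<close> with \<open>B\<close>.\<close>
  finally have "((\<integral>y. (z \<bullet> y)\<^sup>2 \<partial>\<mu>) - (norm z)\<^sup>2 / n)\<^sup>2
      \<le> (\<Sum>(i,j)\<in>UNIV. (z $ i * z $ j)\<^sup>2) * (\<Sum>(i,j)\<in>UNIV. (B i j)\<^sup>2)"
    using Cauchy_Schwarz_ineq_sum[of "\<lambda>(i,j). z $ i * z $ j" "\<lambda>(i,j). B i j" UNIV]
    by (simp add: case_prod_unfold)
  also have "(\<Sum>(i,j)\<in>UNIV. (z $ i * z $ j)\<^sup>2) = (\<Sum>i\<in>UNIV. z $ i * z $ i) * (\<Sum>i\<in>UNIV. z $ i * z $ i)"
    by (simp add: sum_product sum.cartesian_product power2_eq_square mult_ac)
  also have "\<dots> = norm z ^ 4" unfolding znorm by (simp add: power2_eq_square power4_eq_xxxx)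
  finally show ?thesis by (simp add: BB n_def mult.commute)
qed

text \<open>In \<open>frame_bound\<close> the left side is a square, and a unit vector
  \<open>z\<close> turns the right side into the excess itself.\<close>

lemma frame_potential_ge: "1 / CARD('n) \<le> zonal (\<lambda>t. t\<^sup>2) \<mu>"
proof -
  obtain x where "x \<in> space \<mu>" using not_empty by auto
  then have "norm x = 1" by (rule norm_space)
  then have "0 \<le> (zonal (\<lambda>t. t\<^sup>2) \<mu> - 1 / CARD('n)) * 1 ^ 4"
    using order_trans[OF zero_le_power2 frame_bound[of x]] by simp
  then show ?thesis by simp
qed

text \<open>The three-point inequality is integrated over \<open>y\<close>. Its left side becomes
  the second moment in the direction \<open>x - w\<close>, which \<open>frame_bound\<close> keeps
  above \<open>r\<^sup>2 * (1 / n - \<gamma>)\<close>, where \<gamma> measures the distance from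
  isotropy. This has content when \<gamma> is below \<open>1 / n\<close>.\<close>

lemma err_le_pen:
  assumes x: "norm x = 1" "norm x' = 1"
  defines "\<gamma> \<equiv> sqrt (zonal (\<lambda>t. t\<^sup>2) \<mu> - 1 / CARD('n))"
  shows "(1 / CARD('n) - \<gamma>) * err (x \<bullet> x')
    \<le> 6 * ((\<integral>y. pen (x \<bullet> y) \<partial>\<mu>) + (\<integral>y. pen (x' \<bullet> y) \<partial>\<mu>) + pen (x \<bullet> x'))"
proof -
  \<comment> \<open>Replacing \<open>x'\<close> by its antipode preserves penalties and error and
    makes the inner product nonnegative, as \<open>three_point\<close> demands.\<close>
  define w where "w = (if x \<bullet> x' \<ge> 0 then x' else - x')"
  have w: "norm w = 1" by (simp add: w_def x)
  define t where "t = \<bar>x \<bullet> x'\<bar>"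
  have xw: "x \<bullet> w = t" by (auto simp: w_def t_def)
  have t: "0 \<le> t" "t \<le> 1" using inner_unit_bounds[OF x] by (auto simp: t_def)
  define r where "r = sqrt (2 - 2 * t)"
  have r: "0 \<le> r" "r\<^sup>2 = 2 - 2 * t" using t by (auto simp: r_def)
  define z where "z = x - w"
  have norm_diff_square: "(norm (x - w))\<^sup>2 = (norm x)\<^sup>2 + (norm w)\<^sup>2 - 2 * (x \<bullet> w)"
    by (simp add: power2_norm_eq_inner inner_diff_left inner_diff_right inner_commute)
  have z2: "(norm z)\<^sup>2 = r\<^sup>2"
    using x w r(2) by (simp add: z_def norm_diff_square xw)
  have penw: "pen (w \<bullet> y) = pen (x' \<bullet> y)" for y by (auto simp: w_def)
  have pent: "pen t = pen (x \<bullet> x')" by (auto simp: t_def abs_if)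
  define S where "S = (\<integral>y. pen (x \<bullet> y) \<partial>\<mu>) + (\<integral>y. pen (x' \<bullet> y) \<partial>\<mu>) + pen (x \<bullet> x')"
  have S0: "0 \<le> S" unfolding S_def
    using x by (auto intro!: add_nonneg_nonneg integral_nonneg_AE AE_I2 pen_bounds inner_unit_bounds norm_space)
  have "t * (\<integral>y. (z \<bullet> y)\<^sup>2 \<partial>\<mu>) = (\<integral>y. t * (x \<bullet> y - w \<bullet> y)\<^sup>2 \<partial>\<mu>)"
    by (simp add: z_def inner_diff_left)
  also have "\<dots> \<le> (\<integral>y. 6 * r * (pen (x \<bullet> y) + pen (x' \<bullet> y) + pen (x \<bullet> x')) \<partial>\<mu>)"
  proof (rule integral_mono)
    have "integrable \<mu> (\<lambda>y. (z \<bullet> y)\<^sup>2)"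
      unfolding inner_power2_expand by (auto simp: case_prod_unfold component_integrable)
    then show "integrable \<mu> (\<lambda>y. t * (x \<bullet> y - w \<bullet> y)\<^sup>2)" by (simp add: z_def inner_diff_left)
    show "integrable \<mu> (\<lambda>y. 6 * r * (pen (x \<bullet> y) + pen (x' \<bullet> y) + pen (x \<bullet> x')))"
      using tame_integrable[OF tame_pen] x by simp
    fix y assume "y \<in> space \<mu>"
    then have y: "norm y = 1" by (rule norm_space)
    show "t * (x \<bullet> y - w \<bullet> y)\<^sup>2 \<le> 6 * r * (pen (x \<bullet> y) + pen (x' \<bullet> y) + pen (x \<bullet> x'))"
      using three_point[of "x \<bullet> y" "w \<bullet> y" t] gram3[OF x(1) w y] t
        inner_unit_bounds[OF x(1) y] inner_unit_bounds[OF w y]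
      by (simp add: xw penw pent r_def)
  qed
  also have "\<dots> = 6 * r * S"
    using tame_integrable[OF tame_pen] x by (simp add: S_def prob_space)
  finally have 1: "t * (\<integral>y. (z \<bullet> y)\<^sup>2 \<partial>\<mu>) \<le> r * (6 * S)" by (simp add: mult_ac)
  have "\<bar>(\<integral>y. (z \<bullet> y)\<^sup>2 \<partial>\<mu>) - (norm z)\<^sup>2 / CARD('n)\<bar> \<le> \<gamma> * r\<^sup>2"
  proof -
    have "sqrt (((\<integral>y. (z \<bullet> y)\<^sup>2 \<partial>\<mu>) - (norm z)\<^sup>2 / CARD('n))\<^sup>2)
      \<le> sqrt ((zonal (\<lambda>t. t\<^sup>2) \<mu> - 1 / CARD('n)) * ((norm z)\<^sup>2)\<^sup>2)"
      using frame_bound[of z] by (intro real_sqrt_le_mono) simp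
    then show ?thesis using real_sqrt_abs[of "r\<^sup>2"] by (simp add: real_sqrt_mult \<gamma>_def z2)
  qed
  then have "r\<^sup>2 * (1 / CARD('n) - \<gamma>) \<le> (\<integral>y. (z \<bullet> y)\<^sup>2 \<partial>\<mu>)"
    unfolding z2 by (simp add: algebra_simps)
  then have "t * (r\<^sup>2 * (1 / CARD('n) - \<gamma>)) \<le> r * (6 * S)"
    using order_trans[OF mult_left_mono[OF _ t(1)] 1] by blast
  then have 2: "r * (t * r * (1 / CARD('n) - \<gamma>)) \<le> r * (6 * S)"
    by (simp add: power2_eq_square mult_ac)
  \<comment> \<open>Cancelling one factor \<open>r\<close> leaves the error; if \<open>r = 0\<close>
    the left side vanishes and \<open>S\<close> is nonnegative.\<close>
  have "t * r * (1 / CARD('n) - \<gamma>) \<le> 6 * S"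
  proof (cases "r = 0")
    case True then show ?thesis using S0 by simp
  next
    case False
    then show ?thesis using 2 r by (simp add: mult_le_cancel_left_pos)
  qed
  then show ?thesis by (simp add: S_def err_def t_def r_def mult_ac)
qed

text \<open>Integrating \<open>err_le_pen\<close> over both points turns each of its three penalty
  terms into \<open>zonal pen \<mu>\<close>, whence \<open>18 = 3 * 6\<close>.\<close>

lemma zonal_err_le:
  defines "\<gamma> \<equiv> sqrt (zonal (\<lambda>t. t\<^sup>2) \<mu> - 1 / CARD('n))"
  shows "(1 / CARD('n) - \<gamma>) * zonal err \<mu> \<le> 18 * zonal pen \<mu>"
proof -
  define P where "P x = (\<integral>y. pen (x \<bullet> y) \<partial>\<mu>)" for x
  have Pi: "integrable \<mu> P" unfolding P_def by (rule pot_integrable[OF tame_pen])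
  have inner: "(\<integral>x'. (1 / CARD('n) - \<gamma>) * err (x \<bullet> x') \<partial>\<mu>) \<le> 6 * (P x + zonal pen \<mu> + P x)"
    if "x \<in> space \<mu>" for x
  proof -
    have x: "norm x = 1" using that by (rule norm_space)
    have i: "integrable \<mu> (\<lambda>y. pen (x \<bullet> y))" using tame_integrable[OF tame_pen x] .
    have "(\<integral>x'. (1 / CARD('n) - \<gamma>) * err (x \<bullet> x') \<partial>\<mu>) \<le> (\<integral>x'. 6 * (P x + P x' + pen (x \<bullet> x')) \<partial>\<mu>)"
      using x Pi i tame_integrable[OF tame_err x] err_le_pen[OF x norm_space] unfolding \<gamma>_def P_def
      by (intro integral_mono) auto
    also have "\<dots> = 6 * (P x + zonal pen \<mu> + P x)"
      using Pi i by (simp add: prob_space) (simp add: P_def[abs_def] zonal_def)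
    finally show ?thesis .
  qed
  have "(1 / CARD('n) - \<gamma>) * zonal err \<mu> = (\<integral>x. (\<integral>x'. (1 / CARD('n) - \<gamma>) * err (x \<bullet> x') \<partial>\<mu>) \<partial>\<mu>)"
    by (simp add: zonal_def)
  also have "\<dots> \<le> (\<integral>x. 6 * (P x + zonal pen \<mu> + P x) \<partial>\<mu>)"
    using Pi inner pot_integrable[OF tame_err] by (intro integral_mono) auto
  also have "\<dots> = 18 * zonal pen \<mu>"
    using Pi by (simp add: prob_space) (simp add: P_def[abs_def] zonal_def)
  finally show ?thesis .
qed

text \<open>The value of \<open>k\<close> serves two demands: \<open>36 * n * k \<le> 1 / 4\<close>
  for nearly isotropic measures and \<open>2 * k \<le> 1 / (4 * n\<^sup>2)\<close> for the
  others.\<close>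

lemma zonal_lam_pow_le:
  assumes k: "k = 1 / (144 * (real CARD('n))\<^sup>2)"
  shows "zonal (lam_pow (ereal (2 - k))) \<mu> \<le> 1 - 1 / CARD('n)"
proof -
  define n where "n = real CARD('n)"
  have n1: "1 \<le> n" by (simp add: n_def Suc_le_eq)
  then have n2: "1 * 1 \<le> n * n" by (intro mult_mono) auto
  have kn2: "k * (n * n) = 1 / 144" using n1 by (simp add: k n_def power2_eq_square)
  have k0: "0 < k" using n1 by (simp add: k n_def)
  then have "k * (1 * 1) \<le> k * (n * n)" "k * (n * 1) \<le> k * (n * n)"
    using n1 n2 by (intro mult_left_mono; simp)+
  then have k1: "k < 1" and kn: "k * (36 * n) \<le> 1 / 4" using kn2 by auto
  have k4: "2 * k \<le> 1 / (4 * n\<^sup>2)" using kn2 n1 by (simp add: pos_le_divide_eq power2_eq_square)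
  define F where "F = zonal (\<lambda>t. t\<^sup>2) \<mu>"
  have "zonal (lam_pow (ereal (2 - k))) \<mu> \<le> zonal (\<lambda>t. 1 - t\<^sup>2 - (1/4) * pen t + k * err t) \<mu>"
    using k0 k1 lam_powr_le[of _ k]
    by (intro zonal_mono tame_lam_pow tame_add tame_diff tame_cmult tame_const tame_power2 tame_pen tame_err)
      (auto simp: pen_def err_def)
  also have "\<dots> = 1 - F - (1/4) * zonal pen \<mu> + k * zonal err \<mu>"
    by (simp only: F_def zonal_add zonal_diff zonal_cmult zonal_const
        tame_add tame_diff tame_cmult tame_const tame_power2 tame_pen tame_err)
  finally have le: "zonal (lam_pow (ereal (2 - k))) \<mu> \<le> 1 - F - (1/4) * zonal pen \<mu> + k * zonal err \<mu>" .
  have F: "1 / n \<le> F" using frame_potential_ge by (simp add: F_def n_def)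
  have pen0: "0 \<le> zonal pen \<mu>" and err0: "0 \<le> zonal err \<mu>" and err2: "zonal err \<mu> \<le> 2"
    using zonal_mono[OF tame_const tame_pen, of 0] zonal_mono[OF tame_const tame_err, of 0]
      zonal_mono[OF tame_err tame_const, of 2] pen_bounds err_bounds by (auto simp: zonal_const)
  show ?thesis
  proof (cases "sqrt (F - 1 / n) \<le> 1 / (2 * n)")
    \<comment> \<open>Nearly isotropic: at least half of \<open>1 / n\<close> survives in
      \<open>zonal_err_le\<close>, so the penalty absorbs the error.\<close>
    case True
    have "(1 / (2 * n)) * zonal err \<mu> \<le> (1 / n - sqrt (F - 1 / n)) * zonal err \<mu>"
    proof (rule mult_right_mono[OF _ err0])
      have "1 / n = 1 / (2 * n) + 1 / (2 * n)" using n1 by (simp add: field_simps)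
      then show "1 / (2 * n) \<le> 1 / n - sqrt (F - 1 / n)" using True by linarith
    qed
    also have "\<dots> \<le> 18 * zonal pen \<mu>" using zonal_err_le by (simp add: F_def n_def)
    finally have "zonal err \<mu> \<le> 36 * n * zonal pen \<mu>" using n1 by (simp add: field_simps)
    then have "k * zonal err \<mu> \<le> k * (36 * n * zonal pen \<mu>)" using k0 by (intro mult_left_mono) auto
    also have "\<dots> = k * (36 * n) * zonal pen \<mu>" by simp
    also have "\<dots> \<le> 1 / 4 * zonal pen \<mu>" using kn pen0 by (rule mult_right_mono)
    finally show ?thesis using le F by (simp add: n_def)
  next
    \<comment> \<open>Far from isotropic: the frame potential exceeds its minimum by at least
      \<open>1 / (4 * n\<^sup>2)\<close>, which pays for the crude bound \<open>2\<close> on the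
      error.\<close>
    case False
    then have "(1 / (2 * n))\<^sup>2 \<le> (sqrt (F - 1 / n))\<^sup>2" using n1 by (intro power_mono) auto
    then have "1 / (4 * n\<^sup>2) \<le> F - 1 / n" using F by (simp add: power_divide power_mult_distrib)
    moreover have "k * zonal err \<mu> \<le> k * 2" using k0 err2 by (intro mult_left_mono) auto
    ultimately show ?thesis using le k4 pen0 by (simp add: n_def)
  qed
qed

end

section \<open>Measures equidistributed on an orthonormal basis\<close>

lemma unit_inner_eq_1:
  fixes x y :: "'a::real_inner"
  assumes "norm x = 1" "norm y = 1"
  shows "x \<bullet> y = 1 \<longleftrightarrow> y = x" "x \<bullet> y = - 1 \<longleftrightarrow> y = - x"
proof -
  have *: "y = x" if "norm x = 1" "norm y = 1" "x \<bullet> y = 1" for x y :: 'a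
  proof -
    have "(norm (y - x))\<^sup>2 = (norm y)\<^sup>2 - 2 * (x \<bullet> y) + (norm x)\<^sup>2"
      by (simp add: power2_norm_eq_inner inner_diff_left inner_diff_right inner_commute)
    then show ?thesis using that by simp
  qed
  show "x \<bullet> y = 1 \<longleftrightarrow> y = x" using *[of x y] assms by (auto simp: dot_square_norm)
  show "x \<bullet> y = - 1 \<longleftrightarrow> y = - x" using *[of "- x" y] assms by (auto simp: dot_square_norm)
qed

lemma prob_measures_sphere_iff: "\<mu> \<in> prob_measures_sphere \<longleftrightarrow> sphere_prob \<mu>"
  by (simp add: prob_measures_sphere_def sphere_prob_def sphere_prob_axioms_def)

lemma card_orthonormal_basis:
  fixes B :: "(real^'n) set"
  assumes "orthonormal_basis B"
  shows "finite B" "card B = CARD('n)"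
proof -
  have B: "pairwise orthogonal B" "\<And>v. v \<in> B \<Longrightarrow> norm v = 1" "span B = UNIV"
    using assms by (auto simp: orthonormal_basis_def)
  have ind: "independent B"
    using B(1) B(2)[of 0] by (intro pairwise_orthogonal_independent) auto
  then show "finite B" by (rule independent_imp_finite)
  have "card B = dim (UNIV :: (real^'n) set)"
    using ind B(3) by (intro basis_card_eq_dim) auto
  then show "card B = CARD('n)" by simp
qed

context sphere_prob
begin

lemma energy_eq: "energy \<alpha> \<mu> = zonal (lam_pow \<alpha>) \<mu> / 2"
proof -
  have "(\<integral>x. (\<integral>y. Lam_pow \<alpha> x y \<partial>\<mu>) \<partial>\<mu>) = zonal (lam_pow \<alpha>) \<mu>"
    unfolding zonal_def
    by (intro Bochner_Integration.integral_cong refl Lam_pow_eq norm_space) auto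
  then show ?thesis by (simp add: energy_def)
qed

lemma zonal_cong_AE:
  assumes "tame f" "tame g" "AE x in \<mu>. AE y in \<mu>. f (x \<bullet> y) = g (x \<bullet> y)"
  shows "zonal f \<mu> = zonal g \<mu>"
  unfolding zonal_def
proof (rule integral_cong_AE)
  show "(\<lambda>x. \<integral>y. f (x \<bullet> y) \<partial>\<mu>) \<in> borel_measurable \<mu>" "(\<lambda>x. \<integral>y. g (x \<bullet> y) \<partial>\<mu>) \<in> borel_measurable \<mu>"
    using pot_integrable assms by (auto intro: borel_measurable_integrable)
  have "AE x in \<mu>. x \<in> space \<mu>" by simp
  with assms(3) show "AE x in \<mu>. (\<integral>y. f (x \<bullet> y) \<partial>\<mu>) = (\<integral>y. g (x \<bullet> y) \<partial>\<mu>)"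
  proof eventually_elim
    case (elim x)
    then show ?case using assms tame_integrable norm_space
      by (intro integral_cong_AE) (auto intro: borel_measurable_integrable)
  qed
qed

text \<open>From any point of the support, the kernel is \<open>0\<close> on its own antipodal pair
  and \<open>1\<close> on all other pairs, whatever the exponent.\<close>

lemma zonal_P_Delta_eq:
  assumes P: "\<mu> \<in> P_Delta_eq" and \<alpha>: "0 < \<alpha>"
  shows "zonal (lam_pow \<alpha>) \<mu> = 1 - 1 / CARD('n)"
proof -
  obtain B where ob: "orthonormal_basis B" and mB: "\<And>v. v \<in> B \<Longrightarrow> prob {v, -v} = 1 / CARD('n)"
    using P by (auto simp: P_Delta_eq_def)
  have B: "pairwise orthogonal B" "\<And>v. v \<in> B \<Longrightarrow> norm v = 1" "span B = UNIV"
    using ob by (auto simp: orthonormal_basis_def)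
  have pm: "{v, -v} \<in> sets \<mu>" if "v \<in> B" for v using that B(2) by (intro pair_sets) auto
  have ort: "v \<bullet> w = 0" if "v \<in> B" "w \<in> B" "v \<noteq> w" for v w
    using B(1) that by (auto simp: pairwise_def orthogonal_def)
  \<comment> \<open>The antipodal pairs are disjoint and their masses add up to \<open>1\<close>, so
    they carry the whole measure.\<close>
  have "prob (\<Union>v\<in>B. {v, -v}) = (\<Sum>v\<in>B. prob {v, -v})"
  proof (rule finite_measure_finite_Union)
    show "disjoint_family_on (\<lambda>v. {v, -v}) B"
      unfolding disjoint_family_on_def
    proof (intro ballI impI)
      fix v w assume vw: "v \<in> B" "w \<in> B" "v \<noteq> w"
      have "v \<bullet> v = 1" using vw B(2) by (simp add: dot_square_norm)
      then show "{v, -v} \<inter> {w, -w} = {}" using ort[OF vw] by auto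
    qed
  qed (use pm card_orthonormal_basis[OF ob] in auto)
  also have "\<dots> = 1" using mB card_orthonormal_basis[OF ob] by simp
  finally have "AE x in \<mu>. x \<in> (\<Union>v\<in>B. {v, -v})" by (rule AE_prob_1)
  then have supp: "AE x in \<mu>. \<exists>v\<in>B. x \<in> {v, -v}" by eventually_elim auto
  have pot: "(\<integral>y. lam_pow \<alpha> (x \<bullet> y) \<partial>\<mu>) = 1 - 1 / CARD('n)" if u: "u \<in> B" "x \<in> {u, -u}" for x u
  proof -
    have nx: "norm x = 1" using u B(2) by auto
    have "(\<integral>y. lam_pow \<alpha> (x \<bullet> y) \<partial>\<mu>) = (\<integral>y. 1 - indicator {u, -u} y \<partial>\<mu>)"
    proof (rule integral_cong_AE)
      show "(\<lambda>y. lam_pow \<alpha> (x \<bullet> y)) \<in> borel_measurable \<mu>"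
        using tame_integrable[OF tame_lam_pow[OF \<alpha>] nx] by (rule borel_measurable_integrable)
      show "(\<lambda>y. 1 - indicator {u, -u} y :: real) \<in> borel_measurable \<mu>"
        using pm[OF u(1)] by measurable
      show "AE y in \<mu>. lam_pow \<alpha> (x \<bullet> y) = 1 - indicator {u, -u} y"
        using supp
      proof eventually_elim
        case (elim y)
        then obtain v where v: "v \<in> B" "y \<in> {v, -v}" by auto
        show ?case
        proof (cases "v = u")
          case True
          then have "u \<bullet> u = 1" using u B(2) by (simp add: dot_square_norm)
          then have "\<bar>x \<bullet> y\<bar> = 1" "y \<in> {u, -u}" using u v True by auto
          then show ?thesis using lam_pow_01[OF \<alpha>, of "x \<bullet> y"] by (auto simp: indicator_def)
        next
          case False
          then have 0: "u \<bullet> v = 0" "u \<bullet> u = 1" using ort u v B(2) by (auto simp: dot_square_norm)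
          then have "x \<bullet> y = 0" using u v by auto
          moreover have "y \<notin> {u, -u}" using 0 v by auto
          ultimately show ?thesis using lam_pow_01[OF \<alpha>, of "0"] by (auto simp: indicator_def)
        qed
      qed
    qed
    also have "\<dots> = 1 - prob {u, -u}"
      using pm[OF u(1)] by (subst Bochner_Integration.integral_diff) (simp_all add: prob_space less_top[symmetric])
    finally show ?thesis using mB[OF u(1)] by simp
  qed
  have "zonal (lam_pow \<alpha>) \<mu> = (\<integral>x. 1 - 1 / CARD('n) \<partial>\<mu>)"
    unfolding zonal_def
  proof (rule integral_cong_AE)
    show "AE x in \<mu>. (\<integral>y. lam_pow \<alpha> (x \<bullet> y) \<partial>\<mu>) = 1 - 1 / CARD('n)"
      using supp by eventually_elim (use pot in blast)
  qed (use pot_integrable[OF tame_lam_pow[OF \<alpha>]] in \<open>auto intro: borel_measurable_integrable\<close>)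
  then show ?thesis by (simp add: prob_space)
qed

text \<open>Equality in the frame potential bound makes the measure isotropic, so each point \<open>x\<close> of the
  support, seeing only \<open>\<plusminus>x\<close> and its orthogonal complement, carries mass \<open>1/n\<close> on \<open>{x, -x}\<close>.\<close>

lemma P_Delta_eqI:
  assumes fp: "zonal (\<lambda>t. t\<^sup>2) \<mu> = 1 / CARD('n)"
    and orth: "AE x in \<mu>. AE y in \<mu>. x \<bullet> y \<in> {0, 1, -1}"
  shows "\<mu> \<in> P_Delta_eq"
proof -
  have iso: "(\<integral>y. (z \<bullet> y)\<^sup>2 \<partial>\<mu>) = (norm z)\<^sup>2 / CARD('n)" for z
    using frame_bound[of z] by (simp add: fp)
  define G where "G = {x \<in> space \<mu>. AE y in \<mu>. x \<bullet> y \<in> {0, 1, -1}}"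
  have AEG: "AE x in \<mu>. x \<in> G"
    using orth AE_space by eventually_elim (simp add: G_def)
  have nG: "norm x = 1" if "x \<in> G" for x using that norm_space by (auto simp: G_def)
  have pG: "{x, -x} \<in> sets \<mu>" if "x \<in> G" for x using nG[OF that] by (intro pair_sets) auto
  have mG: "prob {x, -x} = 1 / CARD('n)" if x: "x \<in> G" for x
  proof -
    have "(\<integral>y. (x \<bullet> y)\<^sup>2 \<partial>\<mu>) = (\<integral>y. indicator {x, -x} y \<partial>\<mu>)"
    proof (rule integral_cong_AE)
      show "(\<lambda>y. (x \<bullet> y)\<^sup>2) \<in> borel_measurable \<mu>"
        using tame_integrable[OF tame_power2 nG[OF x]] by (rule borel_measurable_integrable)
      show "(indicator {x, -x} :: _ \<Rightarrow> real) \<in> borel_measurable \<mu>" using pG[OF x] by measurable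
      have "AE y in \<mu>. x \<bullet> y \<in> {0, 1, -1}" using x by (simp add: G_def)
      then show "AE y in \<mu>. (x \<bullet> y)\<^sup>2 = indicator {x, -x} y"
        using AE_space
      proof eventually_elim
        case (elim y)
        have "norm y = 1" using elim by (intro norm_space)
        then show ?case using elim(1) unit_inner_eq_1[OF nG[OF x], of y] by (auto simp: indicator_def)
      qed
    qed
    then show ?thesis using pG[OF x] by (simp add: iso nG[OF x])
  qed
  \<comment> \<open>The relation holds for every pair in \<open>G\<close>, not just almost every
    one, because each pair \<open>{x', -x'}\<close> has positive mass.\<close>
  have GG: "x \<bullet> x' \<in> {0, 1, -1}" if x: "x \<in> G" "x' \<in> G" for x x'
  proof (rule ccontr)
    assume n: "x \<bullet> x' \<notin> {0, 1, -1}"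
    have "AE y in \<mu>. x \<bullet> y \<in> {0, 1, -1}" using x by (simp add: G_def)
    then have "AE y in \<mu>. y \<notin> {x', -x'}"
    proof eventually_elim
      case (elim y)
      then show ?case using n by auto
    qed
    then have "prob {x', -x'} = 0" using prob_eq_0[OF pG[OF x(2)]] by simp
    then show False using mG[OF x(2)] by simp
  qed
  \<comment> \<open>One representative per antipodal pair, the same for \<open>x\<close> and
    \<open>-x\<close>; otherwise \<open>B\<close> could contain both and fail to be
    orthogonal.\<close>
  define rep where "rep x = (SOME v. v \<in> {x, -x})" for x :: "real^'n"
  have rep: "rep x \<in> {x, -x}" for x unfolding rep_def by (rule someI[of _ x]) simp
  have rep_minus: "rep (- x) = rep x" for x unfolding rep_def by (simp add: insert_commute)
  have rep_set: "{rep x, - rep x} = {x, -x}" for x using rep[of x] by auto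
  define B where "B = rep ` G"
  have "orthonormal_basis B" unfolding orthonormal_basis_def
  proof (intro conjI ballI)
    show "pairwise orthogonal B" unfolding pairwise_def
    proof (intro ballI impI)
      fix v w assume "v \<in> B" "w \<in> B" and ne: "v \<noteq> w"
      then obtain x x' where x: "x \<in> G" "v = rep x" "x' \<in> G" "w = rep x'" by (auto simp: B_def)
      have "x' \<noteq> x" "x' \<noteq> - x" using ne x rep_minus by auto
      then have "x \<bullet> x' = 0"
        using GG[OF x(1,3)] unit_inner_eq_1[OF nG[OF x(1)] nG[OF x(3)]] by auto
      then show "orthogonal v w" using rep[of x] rep[of x'] x by (auto simp: orthogonal_def)
    qed
    fix v assume "v \<in> B"
    then obtain x where "x \<in> G" "v = rep x" unfolding B_def by blast
    then show "norm v = 1" using rep[of x] nG[of x] by auto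
  next
    show "span B = UNIV"
    proof (rule ccontr)
      assume "span B \<noteq> UNIV"
      then have "dim B < DIM(real^'n)"
        using dim_eq_full[of B] dim_subset_UNIV[of B] by linarith
      \<comment> \<open>A direction orthogonal to \<open>B\<close> would have second moment
        \<open>0\<close>, contradicting isotropy.\<close>
      then obtain w where w: "w \<noteq> 0" "\<And>y. y \<in> span B \<Longrightarrow> orthogonal w y"
        by (rule orthogonal_to_subspace_exists) blast
      have w0: "w \<bullet> y = 0" if "y \<in> G" for y
      proof -
        have "orthogonal w (rep y)" using that by (intro w span_base) (auto simp: B_def)
        then show ?thesis using rep[of y] by (auto simp: orthogonal_def)
      qed
      have "AE y in \<mu>. (w \<bullet> y)\<^sup>2 = 0" using AEG by eventually_elim (simp add: w0)
      then have "(\<integral>y. (w \<bullet> y)\<^sup>2 \<partial>\<mu>) = 0" by (rule integral_eq_zero_AE)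
      then show False using iso[of w] w by simp
    qed
  qed
  moreover have "prob {v, -v} = 1 / CARD('n)" if "v \<in> B" for v
    using that mG by (auto simp: B_def rep_set)
  ultimately show ?thesis
    using prob_measures_sphere_iff[of \<mu>] sphere_prob_axioms by (auto simp: P_Delta_eq_def)
qed

text \<open>The energy at \<alpha> is squeezed between \<open>1 - 1/n\<close> and the energy at
  \<beta>, so the two kernels agree almost everywhere. This leaves only inner products
  \<open>0\<close>, \<open>1\<close> and \<open>-1\<close>.\<close>

lemma P_Delta_eq_if_equality:
  assumes "0 < \<beta>" "\<beta> < \<alpha>" and eq: "zonal (lam_pow \<alpha>) \<mu> = 1 - 1 / CARD('n)"
    and le: "zonal (lam_pow \<beta>) \<mu> \<le> 1 - 1 / CARD('n)"
  shows "\<mu> \<in> P_Delta_eq"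
proof -
  have \<alpha>: "0 < \<alpha>" using assms by order
  note tame = tame_lam_pow[OF \<open>0 < \<beta>\<close>] tame_lam_pow[OF \<alpha>]
  have ge: "zonal (lam_pow \<alpha>) \<mu> \<le> zonal (lam_pow \<beta>) \<mu>"
    using assms by (intro zonal_mono tame lam_pow_antimono)
  have "AE x in \<mu>. AE y in \<mu>. lam_pow \<beta> (x \<bullet> y) - lam_pow \<alpha> (x \<bullet> y) = 0"
    using assms ge lam_pow_antimono(1)
    by (intro zonal_eq_0D) (auto simp: zonal_diff tame intro: tame_diff)
  with AE_space have "AE x in \<mu>. AE y in \<mu>. x \<bullet> y \<in> {0, 1, -1}"
  proof eventually_elim
    case (elim x)
    from AE_space elim(2) show ?case
    proof eventually_elim
      case (elim y)
      have b: "\<bar>x \<bullet> y\<bar> \<le> 1" using elim \<open>x \<in> space \<mu>\<close> by (intro inner_unit_bounds norm_space)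
      then have "lam (x \<bullet> y) = 0 \<or> lam (x \<bullet> y) = 1"
        using elim assms by (intro lam_pow_antimono(2)[of \<beta> \<alpha>]) auto
      then show ?case using b by (auto simp: lam_eq_0_iff lam_eq_1_iff)
    qed
  qed
  note orth = this
  \<comment> \<open>On these three values the kernel is \<open>1 - t\<^sup>2\<close>, so the energy
    determines the frame potential.\<close>
  have "zonal (\<lambda>t. t\<^sup>2) \<mu> = zonal (\<lambda>t. 1 - lam_pow \<alpha> t) \<mu>"
  proof (rule zonal_cong_AE)
    show "AE x in \<mu>. AE y in \<mu>. (x \<bullet> y)\<^sup>2 = 1 - lam_pow \<alpha> (x \<bullet> y)"
      using orth
    proof eventually_elim
      case (elim x)
      then show ?case
      proof eventually_elim
        case (elim y)
        then show ?case
          using lam_pow_01[OF \<alpha>, of 0] lam_pow_01[OF \<alpha>, of 1] lam_pow_01[OF \<alpha>, of "-1"] by auto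
      qed
    qed
  qed (auto intro: tame_power2 tame_diff tame_const tame)
  also have "\<dots> = 1 / CARD('n)" by (simp add: zonal_diff tame_const tame zonal_const eq)
  finally show ?thesis using orth by (rule P_Delta_eqI)
qed

end

section \<open>Splitting a point mass: failure of optimality below exponent 1\<close>

definition tilt :: "'n::finite \<Rightarrow> 'n \<Rightarrow> real \<Rightarrow> 'n \<times> bool \<Rightarrow> real^'n" where
  "tilt a b \<phi> = (\<lambda>(i, s). if i = a
     then cos \<phi> *\<^sub>R axis a 1 + (if s then sin \<phi> else - sin \<phi>) *\<^sub>R axis b 1 else axis i 1)"

text \<open>The uniform measure on an orthonormal basis, with the mass at the \<open>a\<close>-th basis vector split
  into two halves that are rotated by \<open>\<plusminus>\<phi>\<close> in the plane spanned by the \<open>a\<close>-th and \<open>b\<close>-th vectors.\<close>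

definition tilted :: "'n::finite \<Rightarrow> 'n \<Rightarrow> real \<Rightarrow> (real^'n) measure" where
  "tilted a b \<phi> = distr (measure_pmf (pmf_of_set UNIV)) (restrict_space borel (sphere 0 1)) (tilt a b \<phi>)"

lemma inner_axis_axis_1: "axis i 1 \<bullet> (axis j 1 :: real^'n) = (if i = j then 1 else 0)"
  by (simp add: inner_axis_axis)

lemma norm_tilt:
  assumes "a \<noteq> b" shows "norm (tilt a b \<phi> p) = 1"
proof -
  have "tilt a b \<phi> p \<bullet> tilt a b \<phi> p = 1"
    using assms sin_cos_squared_add2[of \<phi>]
    by (cases p) (auto simp: tilt_def inner_add_left inner_add_right inner_axis_axis_1 power2_eq_square algebra_simps)
  then show ?thesis by (simp add: norm_eq_1)
qed

lemma tilt_measurable: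
  assumes "a \<noteq> b"
  shows "tilt a b \<phi> \<in> measure_pmf p \<rightarrow>\<^sub>M restrict_space borel (sphere 0 1)"
  using assms by (auto simp: measurable_def space_restrict_space norm_tilt)

lemma sphere_prob_tilted:
  assumes "a \<noteq> b"
  shows "sphere_prob (tilted a b \<phi>)"
proof -
  have "prob_space (tilted a b \<phi>)"
    unfolding tilted_def by (rule measure_pmf.prob_space_distr[OF tilt_measurable[OF assms]])
  then show ?thesis by (simp add: sphere_prob_def sphere_prob_axioms_def tilted_def)
qed

text \<open>The boolean labels the two halves of each point mass, of weight
  \<open>1 / (2 * n)\<close> each; away from the index \<open>a\<close> the halves coincide.\<close>

lemma integral_tilted:
  fixes f :: "real^'n \<Rightarrow> real"
  assumes "a \<noteq> b" "integrable (tilted a b \<phi>) f"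
  shows "(\<integral>x. f x \<partial>tilted a b \<phi>) = (\<Sum>p\<in>UNIV. f (tilt a b \<phi> p)) / (2 * CARD('n))"
proof -
  have "f \<in> borel_measurable (restrict_space borel (sphere 0 1))"
    using borel_measurable_integrable[OF assms(2)] by (simp add: tilted_def)
  then show ?thesis unfolding tilted_def
    by (subst integral_distr[OF tilt_measurable[OF assms(1)]])
      (simp_all add: integral_pmf_of_set card_UNIV_bool mult.commute)
qed

lemma zonal_tilted:
  fixes a b :: "'n::finite"
  assumes "a \<noteq> b" "tame f"
  shows "zonal f (tilted a b \<phi>) =
    (\<Sum>p\<in>UNIV. \<Sum>q\<in>UNIV. f (tilt a b \<phi> p \<bullet> tilt a b \<phi> q)) / (2 * CARD('n))\<^sup>2"
proof -
  interpret sphere_prob "tilted a b \<phi>" by (rule sphere_prob_tilted[OF assms(1)])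
  show ?thesis
    unfolding zonal_def
    by (simp add: integral_tilted[OF assms(1) pot_integrable[OF assms(2)]]
        integral_tilted[OF assms(1) tame_integrable[OF assms(2) norm_tilt[OF assms(1)]]]
        sum_divide_distrib power2_eq_square)
qed

text \<open>At angle \<open>0\<close> the halves coincide again. This witnesses that the class is
  nonempty, on which uniqueness of the threshold and the description of the maximizers rest.\<close>

lemma tilted_0_P_Delta:
  fixes a b :: "'n::finite"
  assumes "a \<noteq> b"
  shows "tilted a b 0 \<in> P_Delta_eq"
proof -
  interpret sphere_prob "tilted a b 0" by (rule sphere_prob_tilted[OF assms])
  define B :: "(real^'n) set" where "B = range (\<lambda>i. axis i 1)"
  have neg: "axis i 1 \<noteq> - (axis j 1 :: real^'n)" for i j
    by (auto simp: axis_def vec_eq_iff dest: spec[of _ i] split: if_splits)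
  have "prob {axis i 1, - axis i 1} = 1 / CARD('n)" for i
  proof -
    have "tilt a b 0 -` {axis i 1, - axis i 1} = {(i, True), (i, False)}"
      using neg by (auto simp: tilt_def axis_eq_axis split: if_splits)
    moreover have "prob {axis i 1, - axis i 1}
        = measure (measure_pmf (pmf_of_set UNIV)) (tilt a b 0 -` {axis i 1, - axis i 1})"
      using pair_sets[of "axis i 1" "- axis i 1"] unfolding tilted_def
      by (subst measure_distr[OF tilt_measurable[OF assms]]) (auto simp: tilted_def)
    ultimately show ?thesis by (simp add: measure_pmf_of_set card_UNIV_bool)
  qed
  moreover have "orthonormal_basis B"
  proof -
    have "Basis \<subseteq> B" by (auto simp: Basis_vec_def B_def)
    then have "span B = UNIV" using span_mono[of Basis B] span_Basis by auto
    then show ?thesis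
      by (auto simp: orthonormal_basis_def B_def pairwise_def orthogonal_def inner_axis_axis)
  qed
  ultimately show ?thesis
    using prob_measures_sphere_iff sphere_prob_axioms by (auto simp: P_Delta_eq_def B_def)
qed

text \<open>Splitting gains \<open>v powr r\<close> from the new pair and loses at most \<open>2 v\<close> against the \<open>b\<close>-th vector.\<close>

lemma zonal_tilted_ge:
  fixes a b :: "'n::finite"
  assumes ab: "a \<noteq> b" and r: "0 < r" "r < 1" and v: "0 < v" "v \<le> 1 / 2"
  shows "1 - 1 / CARD('n) + (v powr r - 2 * v) / (2 * (real CARD('n))\<^sup>2)
    \<le> zonal (lam_pow (ereal r)) (tilted a b (pi * v / 4))"
proof -
  \<comment> \<open>With this angle \<Lambda> is exactly \<open>v\<close> between the two halves and
    \<open>1 - v / 2\<close> between a half and the \<open>b\<close>-th vector.\<close>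
  define \<phi> where "\<phi> = pi * v / 4"
  have \<phi>: "0 \<le> \<phi>" "2 * \<phi> \<le> pi / 2" using v by (auto simp: \<phi>_def field_simps)
  define n where "n = real CARD('n)"
  have n0: "0 < n" by (simp add: n_def)
  define w where "w = v powr r"
  define f where "f p q = lam_pow (ereal r) (tilt a b \<phi> p \<bullet> tilt a b \<phi> q)" for p q
  \<comment> \<open>A termwise lower bound for \<open>f\<close>, with nested conditionals so that
    each correction can be summed separately.\<close>
  define g :: "'n \<Rightarrow> bool \<Rightarrow> 'n \<Rightarrow> bool \<Rightarrow> real" where
    "g i s j t = 1 - (if i = j then 1 else 0) - (if i = a then if j = b then v / 2 else 0 else 0)
       - (if i = b then if j = a then v / 2 else 0 else 0)
       + (if i = a then if j = a then if s = t then 0 else w else 0 else 0)" for i s j t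
  have lam_sin: "lam (sin \<phi>) = 1 - v / 2"
    using lam_cos[of "pi / 2 - \<phi>"] \<phi> by (simp add: cos_diff) (simp add: \<phi>_def field_simps)
  have lam_minus: "lam (- t) = lam t" for t by (simp add: lam_def)
  have lam_cos2: "lam (cos \<phi> * cos \<phi> - sin \<phi> * sin \<phi>) = v"
    using lam_cos[of "2 * \<phi>"] \<phi> by (simp add: cos_double power2_eq_square) (simp add: \<phi>_def)
  have sc: "cos \<phi> * cos \<phi> + sin \<phi> * sin \<phi> = 1" using sin_cos_squared_add3[of \<phi>] .
  have bern: "1 - v / 2 \<le> (1 - v / 2) powr r"
    using powr_mono'[of r 1 "1 - v / 2"] r v by simp
  have le: "g i s j t \<le> f (i, s) (j, t)" for i s j t
  proof -
    consider "i = a" "j = a" | "i = a" "j = b" | "i = b" "j = a" | "i = j" "i \<noteq> a"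
      | "i \<noteq> j" "\<not> (i = a \<and> j = b)" "\<not> (i = b \<and> j = a)" by blast
    then show ?thesis
    proof cases
      case 1
      have "tilt a b \<phi> (i, s) \<bullet> tilt a b \<phi> (j, t) = (if s = t then 1 else cos \<phi> * cos \<phi> - sin \<phi> * sin \<phi>)"
        using 1 ab sc by (auto simp: tilt_def inner_add_left inner_add_right inner_axis_axis_1)
      then show ?thesis using 1 ab by (simp add: f_def g_def w_def lam_pow_def lam_cos2)
    next
      case 2
      have "tilt a b \<phi> (i, s) \<bullet> tilt a b \<phi> (j, t) = (if s then sin \<phi> else - sin \<phi>)"
        using 2 ab by (auto simp: tilt_def inner_add_left inner_add_right inner_axis_axis_1)
      then show ?thesis using 2 ab bern by (auto simp: f_def g_def lam_pow_def lam_sin lam_minus)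
    next
      case 3
      have "tilt a b \<phi> (i, s) \<bullet> tilt a b \<phi> (j, t) = (if t then sin \<phi> else - sin \<phi>)"
        using 3 ab by (auto simp: tilt_def inner_add_left inner_add_right inner_axis_axis_1)
      then show ?thesis using 3 ab bern by (auto simp: f_def g_def lam_pow_def lam_sin lam_minus)
    next
      case 4
      then show ?thesis using lam_pow_bounds(1) ab by (auto simp: f_def g_def)
    next
      case 5
      have "tilt a b \<phi> (i, s) \<bullet> tilt a b \<phi> (j, t) = 0"
        using 5 ab by (auto simp: tilt_def inner_add_left inner_add_right inner_axis_axis_1)
      then show ?thesis using 5 by (auto simp: f_def g_def lam_pow_def)
    qed
  qed
  have "(\<Sum>p\<in>UNIV. \<Sum>q\<in>UNIV. f p q) = (\<Sum>i\<in>UNIV. \<Sum>s\<in>UNIV. \<Sum>j\<in>UNIV. \<Sum>t\<in>UNIV. f (i, s) (j, t))"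
  proof -
    have "(\<Sum>p\<in>UNIV. h p) = (\<Sum>i\<in>UNIV. \<Sum>s\<in>UNIV. h (i, s))" for h :: "'n \<times> bool \<Rightarrow> real"
      by (simp add: sum.cartesian_product)
    then show ?thesis by simp
  qed
  moreover have "(\<Sum>i\<in>UNIV. \<Sum>s\<in>UNIV. \<Sum>j\<in>UNIV. \<Sum>t\<in>UNIV. g i s j t) \<le> \<dots>"
    by (intro sum_mono le)
  \<comment> \<open>Of the \<open>4 * n * n\<close> terms, \<open>4 * n\<close> have equal indices,
    eight pair \<open>a\<close> with \<open>b\<close> and lose \<open>v / 2\<close> each, and two
    pair the opposite halves and gain \<open>w\<close> each.\<close>
  moreover have "(\<Sum>i\<in>UNIV. \<Sum>s\<in>UNIV. \<Sum>j\<in>UNIV. \<Sum>t\<in>UNIV. g i s j t) = 4 * n * n - 4 * n - 4 * v + 2 * w"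
  proof -
    have "(\<Sum>j\<in>UNIV. if P then h j else 0) = (if P then \<Sum>j\<in>UNIV. h j else 0)"
      for P and h :: "'n \<Rightarrow> real" by simp
    then show ?thesis
      by (simp add: g_def UNIV_bool sum.distrib sum_subtractf sum_distrib_left[symmetric] cong: if_cong)
        (simp add: n_def algebra_simps)
  qed
  ultimately have "4 * n * n - 4 * n - 4 * v + 2 * w \<le> (\<Sum>p\<in>UNIV. \<Sum>q\<in>UNIV. f p q)" by simp
  then have "(4 * n * n - 4 * n - 4 * v + 2 * w) / (2 * n)\<^sup>2
      \<le> zonal (lam_pow (ereal r)) (tilted a b \<phi>)"
    using r by (simp add: zonal_tilted[OF ab tame_lam_pow] f_def n_def divide_right_mono)
  moreover have "(4 * n * n - 4 * n - 4 * v + 2 * w) / (2 * n)\<^sup>2 = 1 - 1 / n + (w - 2 * v) / (2 * n\<^sup>2)"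
    using n0 by (simp add: field_simps power2_eq_square)
  ultimately show ?thesis by (simp add: n_def w_def \<phi>_def)
qed

lemma exists_zonal_gt:
  assumes card: "CARD('n::finite) \<ge> 2" and \<alpha>: "0 < \<alpha>" "\<alpha> < 1"
  shows "\<exists>\<mu>::(real^'n) measure. sphere_prob \<mu> \<and> 1 - 1 / CARD('n) < zonal (lam_pow \<alpha>) \<mu>"
proof -
  obtain r where r: "\<alpha> = ereal r" "0 < r" "r < 1" using \<alpha> by (cases \<alpha>) (auto simp: one_ereal_def)
  obtain a b :: 'n where ab: "a \<noteq> b"
    using card card_le_Suc0_iff_eq[of "UNIV :: 'n set"] by auto
  \<comment> \<open>Chosen so that \<open>v powr (1 - r) = 1 / 4\<close>: then \<open>2 * v\<close>
    is only half of \<open>v powr r\<close>, and the gain exceeds the loss.\<close>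
  define v :: real where "v = (1 / 4) powr (1 / (1 - r))"
  have v0: "0 < v" by (simp add: v_def)
  have "v \<le> (1 / 4) powr 1"
    unfolding v_def using r by (intro powr_mono') auto
  then have v1: "v \<le> 1 / 2" by simp
  have "v = v powr r * v powr (1 - r)" using v0 by (simp add: powr_add[symmetric])
  also have "v powr (1 - r) = 1 / 4" using r by (simp add: v_def powr_powr)
  finally have "v powr r - 2 * v > 0" using v0 by simp
  then have "0 < (v powr r - 2 * v) / (2 * (real CARD('n))\<^sup>2)" by simp
  then show ?thesis
    using zonal_tilted_ge[OF ab r(2,3) v0 v1] sphere_prob_tilted[OF ab] r(1)
    by (intro exI[of _ "tilted a b (pi * v / 4)"]) auto
qed

section \<open>The threshold exponent\<close>

text \<open>The bound is the common value on \<open>P_Delta_eq\<close>, so on a nonempty class this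
  says that its members are maximizers; the factor \<open>1/2\<close> of the energy is
  dropped.\<close>

definition simplex_optimal :: "'n::finite itself \<Rightarrow> ereal \<Rightarrow> bool" where
  "simplex_optimal _ \<alpha> \<longleftrightarrow> 0 < \<alpha> \<and>
     (\<forall>\<mu>::(real^'n) measure. sphere_prob \<mu> \<longrightarrow> zonal (lam_pow \<alpha>) \<mu> \<le> 1 - 1 / CARD('n))"

lemma argmax_iff:
  fixes \<mu> :: "(real^'n) measure"
  shows "\<mu> \<in> argmax_energy \<alpha> \<longleftrightarrow> sphere_prob \<mu> \<and>
     (\<forall>\<nu>::(real^'n) measure. sphere_prob \<nu> \<longrightarrow> zonal (lam_pow \<alpha>) \<nu> \<le> zonal (lam_pow \<alpha>) \<mu>)"
  by (auto simp: argmax_energy_def is_arg_max_def prob_measures_sphere_iff sphere_prob.energy_eq not_less)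

lemma P_Delta_sphere_prob: "\<mu> \<in> P_Delta_eq \<Longrightarrow> sphere_prob \<mu>"
  by (simp add: P_Delta_eq_def prob_measures_sphere_iff)

lemma simplex_optimalI:
  assumes "0 < \<alpha>" "(P_Delta_eq :: (real^'n) measure set) \<inter> argmax_energy \<alpha> \<noteq> {}"
  shows "simplex_optimal TYPE('n) \<alpha>"
proof -
  obtain \<mu> :: "(real^'n) measure" where \<mu>: "\<mu> \<in> P_Delta_eq" "\<mu> \<in> argmax_energy \<alpha>" using assms by auto
  then have "zonal (lam_pow \<alpha>) \<mu> = 1 - 1 / CARD('n)"
    using assms sphere_prob.zonal_P_Delta_eq[OF P_Delta_sphere_prob] by blast
  then show ?thesis using \<mu> assms by (simp add: simplex_optimal_def argmax_iff)
qed

text \<open>A larger exponent lowers the energy of every competitor weakly and leaves that of the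
  simplex measures unchanged. The strict gap between \<beta> and \<alpha> supplies the equality
  case, which rules out other maximizers.\<close>

lemma argmax_eq_P_Delta:
  assumes "simplex_optimal TYPE('n) \<beta>" "\<beta> < \<alpha>" and ne: "(P_Delta_eq :: (real^'n) measure set) \<noteq> {}"
  shows "(P_Delta_eq :: (real^'n) measure set) = argmax_energy \<alpha>"
proof -
  have \<beta>: "0 < \<beta>" and le: "\<And>\<nu>::(real^'n) measure. sphere_prob \<nu> \<Longrightarrow> zonal (lam_pow \<beta>) \<nu> \<le> 1 - 1 / CARD('n)"
    using assms(1) by (auto simp: simplex_optimal_def)
  have \<alpha>: "0 < \<alpha>" using \<beta> assms(2) by order
  have le\<alpha>: "zonal (lam_pow \<alpha>) \<nu> \<le> 1 - 1 / CARD('n)" if "sphere_prob \<nu>" for \<nu> :: "(real^'n) measure"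
  proof -
    interpret sphere_prob \<nu> by fact
    have "zonal (lam_pow \<alpha>) \<nu> \<le> zonal (lam_pow \<beta>) \<nu>"
      using \<alpha> \<beta> assms(2) by (intro zonal_mono tame_lam_pow lam_pow_antimono)
    then show ?thesis using le[OF that] by simp
  qed
  have eq: "zonal (lam_pow \<alpha>) \<mu> = 1 - 1 / CARD('n)" if "\<mu> \<in> P_Delta_eq" for \<mu> :: "(real^'n) measure"
    using sphere_prob.zonal_P_Delta_eq[OF P_Delta_sphere_prob that \<alpha>] that by blast
  obtain \<mu>0 :: "(real^'n) measure" where \<mu>0: "\<mu>0 \<in> P_Delta_eq" using ne by auto
  show ?thesis
  proof (intro equalityI subsetI)
    fix \<mu> :: "(real^'n) measure" assume "\<mu> \<in> P_Delta_eq"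
    then show "\<mu> \<in> argmax_energy \<alpha>" using eq le\<alpha> P_Delta_sphere_prob by (auto simp: argmax_iff)
  next
    fix \<mu> :: "(real^'n) measure" assume "\<mu> \<in> argmax_energy \<alpha>"
    then have \<mu>: "sphere_prob \<mu>" "zonal (lam_pow \<alpha>) \<mu>0 \<le> zonal (lam_pow \<alpha>) \<mu>"
      using P_Delta_sphere_prob[OF \<mu>0] by (auto simp: argmax_iff)
    then have "zonal (lam_pow \<alpha>) \<mu> = 1 - 1 / CARD('n)" using eq[OF \<mu>0] le\<alpha>[OF \<mu>(1)] by simp
    then show "\<mu> \<in> P_Delta_eq"
      using \<mu>(1) \<beta> assms(2) le by (intro sphere_prob.P_Delta_eq_if_equality) auto
  qed
qed

text \<open>At an exponent strictly between two thresholds, the nonempty class would both equal the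
  set of maximizers and be disjoint from it.\<close>

lemma is_threshold_exponent_unique:
  assumes ne: "(P_Delta_eq :: (real^'n) measure set) \<noteq> {}"
    and "is_threshold_exponent TYPE('n) a" "is_threshold_exponent TYPE('n) a'"
  shows "a = a'"
proof -
  have "\<not> x < y" if th: "is_threshold_exponent TYPE('n) x" "is_threshold_exponent TYPE('n) y" for x y
  proof
    assume "x < y"
    then obtain z where z: "x < z" "z < y" using dense by blast
    moreover have "0 < z" using th(1) z(1) less_le_trans[of 0 1 x] by (auto simp: is_threshold_exponent_def)
    ultimately show False using th ne unfolding is_threshold_exponent_def by blast
  qed
  then show ?thesis using assms by (meson linorder_neqE)
qed

theorem corollary3p8:
  fixes d :: nat
  assumes "d \<ge> 1" and "CARD('n::finite) = d + 1"
  shows "threshold_exponent TYPE('n) \<in> {1..<2}"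
proof -
  have card: "CARD('n) \<ge> 2" using assms by simp
  then obtain i j :: 'n where "i \<noteq> j"
    using card_le_Suc0_iff_eq[of "UNIV :: 'n set"] by auto
  then have ne: "(P_Delta_eq :: (real^'n) measure set) \<noteq> {}" using tilted_0_P_Delta by blast
  \<comment> \<open>Below the infimum the simplex measures are not maximal; each exponent above it
    has an optimal one strictly below, as \<open>argmax_eq_P_Delta\<close> requires.\<close>
  define a where "a = Inf {\<beta>. simplex_optimal TYPE('n) \<beta>}"
  have simplex_optimal_ge: "1 \<le> \<beta>" if "simplex_optimal TYPE('n) \<beta>" for \<beta>
  proof (rule ccontr)
    assume "\<not> 1 \<le> \<beta>"
    then show False
      using that exists_zonal_gt[OF card, of \<beta>] by (fastforce simp: simplex_optimal_def)
  qed
  have a1: "1 \<le> a" unfolding a_def by (intro Inf_greatest) (auto intro: simplex_optimal_ge)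
  define k where "k = 1 / (144 * (real CARD('n))\<^sup>2)"
  have "1\<^sup>2 \<le> (real CARD('n))\<^sup>2" using card by (intro power_mono) auto
  then have "1 < 144 * (real CARD('n))\<^sup>2" unfolding one_power2 by linarith
  then have k: "0 < k" "k < 1" unfolding k_def by (simp_all only: divide_less_eq_1_pos) simp_all
  have "simplex_optimal TYPE('n) (ereal (2 - k))"
    using sphere_prob.zonal_lam_pow_le[OF _ k_def] k by (simp add: simplex_optimal_def)
  then have "a \<le> ereal (2 - k)" unfolding a_def by (intro Inf_lower) simp
  also have "\<dots> < 2" using k by (simp add: numeral_eq_ereal)
  finally have a2: "a < 2" .
  have "is_threshold_exponent TYPE('n) a"
    unfolding is_threshold_exponent_def
  proof (intro conjI allI impI)
    show "a \<in> {1..\<infinity>}" using a1 by simp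
    show "(P_Delta_eq :: (real^'n) measure set) \<inter> argmax_energy \<alpha> = {}" if "0 < \<alpha> \<and> \<alpha> < a" for \<alpha>
    proof (rule ccontr)
      assume "(P_Delta_eq :: (real^'n) measure set) \<inter> argmax_energy \<alpha> \<noteq> {}"
      then have "simplex_optimal TYPE('n) \<alpha>" using that by (intro simplex_optimalI) auto
      then have "a \<le> \<alpha>" unfolding a_def by (intro Inf_lower) simp
      then show False using that leD by blast
    qed
    show "(P_Delta_eq :: (real^'n) measure set) = argmax_energy \<alpha>" if lt: "a < \<alpha>" for \<alpha>
    proof -
      obtain \<beta> where "simplex_optimal TYPE('n) \<beta>" "\<beta> < \<alpha>" using lt unfolding a_def Inf_less_iff by auto
      then show ?thesis using ne by (intro argmax_eq_P_Delta)
    qed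
  qed
  then have "threshold_exponent TYPE('n) = a"
    unfolding threshold_exponent_def using is_threshold_exponent_unique[OF ne] by (intro the_equality) auto
  then show ?thesis using a1 a2 by simp
qed

end
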